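(* Let $n\ge3$, let $a_0=\cdots=a_{n-1}=1$, let $a_n\ge2$ and $a_{n+1}\ge1$ be integers. Let $\psi:\tilde{\mathbb{P}}\to\mathbb{P}(1^n,a_n,a_{n+1})$ be the standard weighted blowup along $(x_0=\cdots=x_n=0)$, with exceptional divisor $\mathbb{E}$ and induced weighted bundle structure $\pi:\tilde{\mathbb{P}}\to\mathbb{P}':=\mathbb{P}(1^n,a_n)$. Let $\tilde X\subset\tilde{\mathbb{P}}$ be a quasi-smooth hypersurface of degree $(c,k)$ with $c,k\in\mathbb{Z}_{\ge0}$. Set $p':=[1:0:\cdots:0]\in\mathbb{P}'$. Set $$\tilde{\mathbb{P}}_n:=\tilde{\mathbb{P}},\quad\mathbb{E}_n:=\mathbb{E},\quad\tilde{\mathbb{P}}_{j-1}:=\tilde{\mathbb{P}}_j\cap\pi^*(x_j=0),\quad\mathbb{E}_{j-1}:=\mathbb{E}_j|_{\tilde{\mathbb{P}}_{j-1}}\quad(3\le j\le n),$$ so that for $2\le j\le n-1$ we have $\tilde{\mathbb{P}}_j=\mathbb{P}_{\mathbb{P}^j_{x_0\cdots x_j}}(\mathcal{O}\oplus\mathcal{O}(a_{n+1}))$ and $\mathbb{E}_j\simeq\mathbb{P}^j$ is the negative section. Then there exists $\varphi\in\operatorname{Aut}(\mathbb{P}')$ with $\varphi(p')=p'$ such that, after replacing $\tilde X\subset\tilde{\mathbb{P}}$ with $(\pi^*\varphi)(\tilde X)\subset\tilde{\mathbb{P}}$, if we set $$\tilde X_n:=\tilde X\subset\tilde{\mathbb{P}}_n,\qquad\tilde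 X_{j-1}:=\tilde X_j|_{\tilde{\mathbb{P}}_{j-1}}\subset\tilde{\mathbb{P}}_{j-1}\quad(3\le j\le n),$$ then $\tilde X_j\subset\tilde{\mathbb{P}}_j$ is a quasi-smooth hypersurface of degree $(c,k)$ for any $2\le j\le n-1$. Moreover, if we further assume that $\tilde X|_{\mathbb{E}}\subset\mathbb{E}\simeq\mathbb{P}(1^n,a_n)$ is a quasi-smooth hypersurface of degree $c$, then $\varphi$ can be taken such that moreover $\tilde X_j|_{\mathbb{E}_j}\subset\mathbb{E}_j\simeq\mathbb{P}^j$ is smooth of degree $c$ for any $2\le j\le n-1$.
   Context: Everything is over $\mathbb{C}$. The standard weighted blowup in this situation is the toric variety $$\tilde{\mathbb{P}}=\big((\mathbb{A}^{n+1}_{x_0\cdots x_n}\setminus0)\times(\mathbb{A}^2_{y,z}\setminus0)\big)/(\mathbb{C}^* )^2$$ whose Cox ring $\mathbb{C}[x_0,\dots,x_n,y,z]$ is graded by $\operatorname{Cl}(\tilde{\mathbb{P}})\simeq\mathbb{Z}^2$ with $\deg x_i=(a_i,0)$, $\deg y=(0,1)$, $\deg z=(-a_{n+1},1)$. Here $\psi:\tilde{\mathbb{P}}\to\mathbb{P}(1^n,a_n,a_{n+1})$ is the weighted blowup of the point $[0:\cdots:0:1]$ (type $\frac1{a_{n+1}}(a_0,\dots,a_n)$) with weights $\frac1{a_{n+1}}(a_0,\dots,a_n)$, its exceptional divisor is $\mathbb{E}=(z=0)$, which is a section of $\pi:[x_0:\cdots:x_n;y:z]\mapsto[x_0:\cdots:x_n]\in\mathbb{P}(1^n,a_n)$.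 A hypersurface of degree $(c,k)$ in $\tilde{\mathbb{P}}$ is the divisor of a nonzero bihomogeneous polynomial $\tilde F(x_0,\dots,x_n,y,z)$ of that degree; it is quasi-smooth if $(\tilde F=0)$ is smooth in $(\mathbb{A}^{n+1}\setminus0)\times(\mathbb{A}^2\setminus0)$. The same definitions apply to $\tilde{\mathbb{P}}_j$ with coordinates $x_0,\dots,x_j,y,z$ (of bidegrees $\deg x_i=(a_i,0)$ for $0\le i\le j$, $\deg y=(0,1)$, $\deg z=(-a_{n+1},1)$), and $\tilde X_j$ is defined by the polynomial obtained from that of $\tilde X$ by setting $x_{j+1}=\cdots=x_n=0$. Similarly, $\tilde X|_{\mathbb{E}}$ (resp. $\tilde X_j|_{\mathbb{E}_j}$) is defined by setting $y=1$, $z=0$; quasi-smoothness in $\mathbb{P}(1^n,a_n)$ means the affine cone is smooth away from the origin. For $\varphi\in\operatorname{Aut}(\mathbb{P}')$ induced by a graded automorphism of $\mathbb{C}[x_0,\dots,x_n]$, $\pi^*\varphi$ denotes the automorphism of $\tilde{\mathbb{P}}$ acting by it on $x_0,\dots,x_n$ and fixing $y,z$ (so $\pi\circ\pi^*\varphi=\varphi\circ\pi$). *)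

theory Defs
  imports Complex_Main "HOL-Library.Poly_Mapping"
begin

text \<open>
  Multivariate polynomials over the complex numbers are finitely supported functions from
  exponent vectors to coefficients; multiplication is the convolution product of
  \<^theory>\<open>HOL-Library.Poly_Mapping\<close>. The type of variables contains the homogeneous coordinates
  \<open>x\<^sub>0, x\<^sub>1, \<dots>, y, z\<close> for all dimensions at once; the Cox rings of the individual varieties are
  the subrings \<open>cox_ring j\<close> below.
\<close>

datatype cox_var = VarX nat | VarY | VarZ

type_synonym cpoly = "(cox_var \<Rightarrow>\<^sub>0 nat) \<Rightarrow>\<^sub>0 complex"

definition PConst :: "complex \<Rightarrow> cpoly" where
  "PConst c = Poly_Mapping.single 0 c"

definition PVar :: "cox_var \<Rightarrow> cpoly" where
  "PVar v = Poly_Mapping.single (Poly_Mapping.single v 1) 1"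

text \<open>The homomorphism that is \<open>h\<close> on coefficients and sends each variable \<open>v\<close> to \<open>f v\<close>.\<close>

definition poly_hom :: "(complex \<Rightarrow> 'b::comm_semiring_1) \<Rightarrow> (cox_var \<Rightarrow> 'b) \<Rightarrow> cpoly \<Rightarrow> 'b" where
  "poly_hom h f p =
     (\<Sum>m\<in>Poly_Mapping.keys p. h (Poly_Mapping.lookup p m) *
        (\<Prod>v\<in>Poly_Mapping.keys m. f v ^ Poly_Mapping.lookup m v))"

definition peval :: "(cox_var \<Rightarrow> complex) \<Rightarrow> cpoly \<Rightarrow> complex" where
  "peval = poly_hom id"

definition psubst :: "(cox_var \<Rightarrow> cpoly) \<Rightarrow> cpoly \<Rightarrow> cpoly" where
  "psubst = poly_hom PConst"

text \<open>
  If \<open>v\<close> does not occur in \<open>m\<close>, the truncated subtraction of exponent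
  vectors is harmless because the coefficient is 0.
\<close>

definition pdiff :: "cox_var \<Rightarrow> cpoly \<Rightarrow> cpoly" where
  "pdiff v p =
     (\<Sum>m\<in>Poly_Mapping.keys p. Poly_Mapping.single (m - Poly_Mapping.single v 1)
        (of_nat (Poly_Mapping.lookup m v) * Poly_Mapping.lookup p m))"

definition polys_in :: "cox_var set \<Rightarrow> cpoly set" where
  "polys_in V = {p. \<forall>m\<in>Poly_Mapping.keys p. Poly_Mapping.keys m \<subseteq> V}"

definition homogeneous :: "(cox_var \<Rightarrow> int) \<Rightarrow> int \<Rightarrow> cpoly \<Rightarrow> bool" where
  "homogeneous w d p \<longleftrightarrow>
     (\<forall>m\<in>Poly_Mapping.keys p. (\<Sum>v\<in>Poly_Mapping.keys m. int (Poly_Mapping.lookup m v) * w v) = d)"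

text \<open>
  The hypersurface \<open>f = 0\<close> in the affine space with coordinates \<open>V\<close> is smooth at every one of its
  points lying in \<open>U\<close> (Jacobian criterion). Points assign values to all variables; only those of the
  variables in \<open>V\<close> matter when \<open>f\<close> belongs to \<open>polys_in V\<close>.
\<close>

definition smooth_hypersurface_on ::
    "cox_var set \<Rightarrow> (cox_var \<Rightarrow> complex) set \<Rightarrow> cpoly \<Rightarrow> bool" where
  "smooth_hypersurface_on V U f \<longleftrightarrow>
     (\<forall>p\<in>U. peval p f = 0 \<longrightarrow> (\<exists>v\<in>V. peval p (pdiff v f) \<noteq> 0))"

definition xvars :: "nat \<Rightarrow> cox_var set" where
  "xvars j = VarX ` {..j}"

text \<open>
  The toric variety with coordinates \<open>x\<^sub>0, \<dots>, x\<^sub>j, y, z\<close> of bidegrees \<open>(a\<^sub>i, 0)\<close>, \<open>(0, 1)\<close>,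
  \<open>(- e, 1)\<close>: the quotient of \<open>cox_domain j\<close> by the two-dimensional torus. For \<open>j = n\<close> and
  \<open>e = a\<^bsub>n+1\<^esub>\<close> it is the weighted blowup of \<open>P(a\<^sub>0, \<dots>, a\<^sub>n, a\<^bsub>n+1\<^esub>)\<close> at \<open>[0:\<dots>:0:1]\<close>. Its
  hypersurfaces are represented by their bihomogeneous equations.
\<close>

definition cox_ring :: "nat \<Rightarrow> cpoly set" where
  "cox_ring j = polys_in (xvars j \<union> {VarY, VarZ})"

fun cox_deg :: "(nat \<Rightarrow> nat) \<Rightarrow> nat \<Rightarrow> cox_var \<Rightarrow> int \<times> int" where
  "cox_deg a e (VarX i) = (int (a i), 0)"
| "cox_deg a e VarY = (0, 1)"
| "cox_deg a e VarZ = (- int e, 1)"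

definition cox_domain :: "nat \<Rightarrow> (cox_var \<Rightarrow> complex) set" where
  "cox_domain j = {p. (\<exists>i\<le>j. p (VarX i) \<noteq> 0) \<and> (p VarY \<noteq> 0 \<or> p VarZ \<noteq> 0)}"

definition hypersurface :: "(nat \<Rightarrow> nat) \<Rightarrow> nat \<Rightarrow> nat \<Rightarrow> int \<times> int \<Rightarrow> cpoly \<Rightarrow> bool" where
  "hypersurface a e j d F \<longleftrightarrow> F \<in> cox_ring j \<and> F \<noteq> 0 \<and>
     homogeneous (\<lambda>v. fst (cox_deg a e v)) (fst d) F \<and>
     homogeneous (\<lambda>v. snd (cox_deg a e v)) (snd d) F"

definition quasismooth :: "nat \<Rightarrow> cpoly \<Rightarrow> bool" where
  "quasismooth j F \<longleftrightarrow> smooth_hypersurface_on (xvars j \<union> {VarY, VarZ}) (cox_domain j) F"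

text \<open>The equation on the subvariety \<open>x\<^bsub>j+1\<^esub> = x\<^bsub>j+2\<^esub> = \<dots> = 0\<close>.\<close>

definition restrict_x :: "nat \<Rightarrow> cpoly \<Rightarrow> cpoly" where
  "restrict_x j = psubst (\<lambda>v. case v of VarX i \<Rightarrow> if i \<le> j then PVar (VarX i) else 0 | _ \<Rightarrow> PVar v)"

text \<open>
  Restriction to the section \<open>z = 0\<close>, which is identified with the base through \<open>y = 1\<close>.
\<close>

definition restrict_E :: "cpoly \<Rightarrow> cpoly" where
  "restrict_E = psubst (\<lambda>v. case v of VarX i \<Rightarrow> PVar (VarX i) | VarY \<Rightarrow> 1 | VarZ \<Rightarrow> 0)"

fun x_deg :: "(nat \<Rightarrow> nat) \<Rightarrow> cox_var \<Rightarrow> int" where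
  "x_deg a (VarX i) = int (a i)"
| "x_deg a VarY = 0"
| "x_deg a VarZ = 0"

definition wps_hypersurface :: "(nat \<Rightarrow> nat) \<Rightarrow> nat \<Rightarrow> nat \<Rightarrow> cpoly \<Rightarrow> bool" where
  "wps_hypersurface a j d f \<longleftrightarrow> f \<in> polys_in (xvars j) \<and> f \<noteq> 0 \<and> homogeneous (x_deg a) (int d) f"

definition wps_quasismooth :: "nat \<Rightarrow> cpoly \<Rightarrow> bool" where
  "wps_quasismooth j f \<longleftrightarrow> smooth_hypersurface_on (xvars j) {p. \<exists>i\<le>j. p (VarX i) \<noteq> 0} f"

text \<open>
  Smoothness of a hypersurface in the ordinary projective space with coordinates \<open>x\<^sub>0, \<dots>, x\<^sub>j\<close>,
  in each of the standard affine charts \<open>x\<^sub>i \<noteq> 0\<close>, where the equation is dehomogenized by \<open>x\<^sub>i = 1\<close>.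
\<close>

definition proj_smooth :: "nat \<Rightarrow> cpoly \<Rightarrow> bool" where
  "proj_smooth j f \<longleftrightarrow>
     (\<forall>i\<le>j. smooth_hypersurface_on (xvars j - {VarX i}) UNIV (psubst (PVar(VarX i := 1)) f))"

text \<open>
  An automorphism \<open>\<phi>\<close> of \<open>P(a\<^sub>0, \<dots>, a\<^sub>n)\<close> is given by its comorphism \<open>\<Phi>\<close>, a graded automorphism of
  the algebra of polynomials in \<open>x\<^sub>0, \<dots>, x\<^sub>n\<close>: on points, the \<open>i\<close>-th coordinate of \<open>\<phi>(p)\<close> is
  the value of \<open>\<Phi>(x\<^sub>i)\<close> at \<open>p\<close>. The values of \<open>\<Phi>\<close> outside that algebra are irrelevant.
\<close>

definition graded_automorphism :: "(nat \<Rightarrow> nat) \<Rightarrow> nat \<Rightarrow> (cpoly \<Rightarrow> cpoly) \<Rightarrow> bool" where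
  "graded_automorphism a n \<Phi> \<longleftrightarrow>
     bij_betw \<Phi> (polys_in (xvars n)) (polys_in (xvars n)) \<and>
     (\<forall>c. \<Phi> (PConst c) = PConst c) \<and>
     (\<forall>p\<in>polys_in (xvars n). \<forall>q\<in>polys_in (xvars n).
        \<Phi> (p + q) = \<Phi> p + \<Phi> q \<and> \<Phi> (p * q) = \<Phi> p * \<Phi> q) \<and>
     (\<forall>d. \<forall>p\<in>polys_in (xvars n). homogeneous (x_deg a) d p \<longrightarrow> homogeneous (x_deg a) d (\<Phi> p))"

text \<open>Equality of the points of \<open>P(a\<^sub>0, \<dots>, a\<^sub>n)\<close> with coordinates \<open>u\<close> and \<open>v\<close>.\<close>

definition wps_same_point :: "(nat \<Rightarrow> nat) \<Rightarrow> nat \<Rightarrow> (nat \<Rightarrow> complex) \<Rightarrow> (nat \<Rightarrow> complex) \<Rightarrow> bool" where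
  "wps_same_point a n u v \<longleftrightarrow> (\<exists>t. t \<noteq> 0 \<and> (\<forall>i\<le>n. v i = t ^ a i * u i))"

definition aut_on_points :: "(cpoly \<Rightarrow> cpoly) \<Rightarrow> (nat \<Rightarrow> complex) \<Rightarrow> nat \<Rightarrow> complex" where
  "aut_on_points \<Phi> u i =
     peval (\<lambda>v. case v of VarX l \<Rightarrow> u l | _ \<Rightarrow> 0) (\<Phi> (PVar (VarX i)))"

definition base_point :: "nat \<Rightarrow> complex" where
  "base_point i = (if i = 0 then 1 else 0)"

text \<open>
  The comorphism of \<open>\<pi>\<^sup>*\<phi>\<close>, acting on \<open>x\<^sub>0, \<dots>, x\<^sub>n\<close> by \<open>\<Phi>\<close> and fixing \<open>y, z\<close>. The image of the
  hypersurface \<open>F = 0\<close> under \<open>\<pi>\<^sup>*\<phi>\<close> has the equation \<open>F \<circ> (\<pi>\<^sup>*\<phi>)\<^sup>-\<^sup>1\<close>, whence the inverse of \<open>\<Phi>\<close>.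
\<close>

definition cox_extend :: "(cpoly \<Rightarrow> cpoly) \<Rightarrow> cpoly \<Rightarrow> cpoly" where
  "cox_extend \<Phi> = psubst (\<lambda>v. case v of VarX i \<Rightarrow> \<Phi> (PVar (VarX i)) | _ \<Rightarrow> PVar v)"

definition image_equation :: "nat \<Rightarrow> (cpoly \<Rightarrow> cpoly) \<Rightarrow> cpoly \<Rightarrow> cpoly" where
  "image_equation n \<Phi> F = cox_extend (inv_into (polys_in (xvars n)) \<Phi>) F"

end

theory Submission
  imports Defs "HOL-Computational_Algebra.Polynomial" "HOL-Analysis.Continuum_Not_Denumerable"
begin

text \<open>
  Generic smoothness is obtained from derivations of \<open>\<complex>\<close>. Choose the coefficients \<open>t\<^sub>i\<close> of a form \<open>h\<close> of
  degree \<open>a\<^sub>j\<close> algebraically independent over a countable subring containing the coefficients of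
  \<open>F\<close>; then there are derivations \<open>D\<^sub>i\<close> of \<open>\<complex>\<close> that kill the coefficients of \<open>F\<close> and satisfy
  \<open>D\<^sub>i t\<^sub>l = \<delta>\<^sub>i\<^sub>l\<close>. If the section \<open>x\<^sub>j = h\<close> of \<open>F = 0\<close> is singular at \<open>p\<close>, then \<open>dF = \<mu> d(x\<^sub>j - h)\<close> at \<open>p\<close>
  with \<open>\<mu> \<noteq> 0\<close>, and applying \<open>D\<^sub>i\<close> to \<open>F(p) = 0\<close> shows that the \<open>i\<close>-th monomial of \<open>h\<close> vanishes at \<open>p\<close>.
  So \<open>p\<close> lies in the fibre over \<open>[1:0:\<dots>:0]\<close>. That fibre is a curve, whereas tangency at one of its
  points would express two independent coefficients of \<open>h\<close> through one coordinate, which the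
  derivations exclude as well.

  Restricting to \<open>x\<^sub>j = h\<close> is the same as applying the shear \<open>x\<^sub>j \<mapsto> x\<^sub>j + h\<close> and restricting to
  \<open>x\<^sub>j = 0\<close>; the shears for \<open>j = n, \<dots>, 3\<close> compose to the required automorphism. The section \<open>\<bbbE>\<close> needs no
  separate argument: the equation of \<open>X|\<^sub>\<bbbE>\<close> is itself a hypersurface equation of degree \<open>(c, 0)\<close>, and
  the same \<open>h\<close> can be chosen generic for finitely many equations at once.
\<close>

section \<open>Derivations of the complex numbers\<close>

locale derivation =
  fixes \<delta> :: "'b::comm_ring_1 \<Rightarrow> 'b"
  assumes add: "\<delta> (x + y) = \<delta> x + \<delta> y"
    and mult: "\<delta> (x * y) = x * \<delta> y + \<delta> x * y"
begin

lemma zero [simp]: "\<delta> 0 = 0"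
  using add[of 0 0] by simp

lemma one [simp]: "\<delta> 1 = 0"
  using mult[of 1 1] by simp

lemma of_nat [simp]: "\<delta> (of_nat n) = 0"
  by (induction n) (simp_all add: add)

lemma power_Suc: "\<delta> (x ^ Suc n) = of_nat (Suc n) * x ^ n * \<delta> x"
proof (induction n)
  case (Suc n)
  have "\<delta> (x ^ Suc (Suc n)) = x * \<delta> (x ^ Suc n) + \<delta> x * x ^ Suc n"
    using mult[of x "x ^ Suc n"] by simp
  then show ?case by (simp only: Suc.IH) (simp add: algebra_simps)
qed simp

lemma power: "\<delta> (x ^ n) = of_nat n * x ^ (n - 1) * \<delta> x"
  by (cases n) (use power_Suc in auto)

lemma sum: "\<delta> (\<Sum>i\<in>I. f i) = (\<Sum>i\<in>I. \<delta> (f i))"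
  by (induction I rule: infinite_finite_induct) (simp_all add: add)

end

section \<open>Subrings, polynomials over them and transcendental numbers\<close>

definition subring :: "'a::idom set \<Rightarrow> bool" where
  "subring S \<longleftrightarrow> 1 \<in> S \<and> (\<forall>x\<in>S. \<forall>y\<in>S. x - y \<in> S \<and> x * y \<in> S)"

definition polys_over :: "'a::idom set \<Rightarrow> 'a poly set" where
  "polys_over S = {p. \<forall>i. coeff p i \<in> S}"

context
  fixes S :: "'a::idom set"
  assumes S: "subring S"
begin

lemma subring_one: "1 \<in> S"
  using S by (simp add: subring_def)

lemma subring_diff: "x \<in> S \<Longrightarrow> y \<in> S \<Longrightarrow> x - y \<in> S"
  and subring_mult: "x \<in> S \<Longrightarrow> y \<in> S \<Longrightarrow> x * y \<in> S"
  using S by (auto simp: subring_def)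

lemma subring_zero: "0 \<in> S"
  using subring_diff[OF subring_one subring_one] by simp

lemma subring_add: "x \<in> S \<Longrightarrow> y \<in> S \<Longrightarrow> x + y \<in> S"
  using subring_diff[of x "0 - y"] subring_diff[of 0 y] subring_zero by simp

lemma subring_of_nat: "of_nat n \<in> S"
  by (induction n) (auto intro: subring_add subring_one subring_zero)

lemma subring_sum: "(\<And>i. i \<in> I \<Longrightarrow> f i \<in> S) \<Longrightarrow> (\<Sum>i\<in>I. f i) \<in> S"
  by (induction I rule: infinite_finite_induct) (auto intro: subring_add subring_zero)

lemma polys_over_diff: "p \<in> polys_over S \<Longrightarrow> q \<in> polys_over S \<Longrightarrow> p - q \<in> polys_over S"
  by (simp add: polys_over_def subring_diff)

lemma polys_over_mult: "p \<in> polys_over S \<Longrightarrow> q \<in> polys_over S \<Longrightarrow> p * q \<in> polys_over S"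
  by (simp add: polys_over_def coeff_mult subring_sum subring_mult)

lemma polys_over_pderiv: "p \<in> polys_over S \<Longrightarrow> pderiv p \<in> polys_over S"
  by (simp add: polys_over_def coeff_pderiv subring_mult subring_of_nat del: of_nat_Suc)

lemma polys_over_0: "0 \<in> polys_over S"
  by (simp add: polys_over_def subring_zero)

lemma polys_over_pCons: "c \<in> S \<Longrightarrow> p \<in> polys_over S \<Longrightarrow> pCons c p \<in> polys_over S"
  by (simp add: polys_over_def coeff_pCons split: nat.split)

lemma polys_over_monom: "c \<in> S \<Longrightarrow> monom c n \<in> polys_over S"
  by (simp add: polys_over_def subring_zero)

end

text \<open>The image is the ring \<open>S\<close>[\<alpha>] generated by \<alpha> over
  \<open>S\<close>; it serves both for extending derivations and for enlarging countable
  rings.\<close>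

lemma subring_poly_image:
  assumes "subring S"
  shows "subring ((\<lambda>p. poly p \<alpha>) ` polys_over S)"
  unfolding subring_def
proof (intro conjI ballI)
  show "1 \<in> (\<lambda>p. poly p \<alpha>) ` polys_over S"
    by (rule image_eqI[of _ _ "[:1:]"])
      (simp_all add: assms polys_over_pCons polys_over_0 subring_one)
next
  fix x y assume "x \<in> (\<lambda>p. poly p \<alpha>) ` polys_over S" "y \<in> (\<lambda>p. poly p \<alpha>) ` polys_over S"
  then obtain p q where pq: "p \<in> polys_over S" "q \<in> polys_over S" "x = poly p \<alpha>" "y = poly q \<alpha>" by auto
  show "x - y \<in> (\<lambda>p. poly p \<alpha>) ` polys_over S"
    by (rule image_eqI[of _ _ "p - q"]) (simp_all add: pq assms polys_over_diff)
  show "x * y \<in> (\<lambda>p. poly p \<alpha>) ` polys_over S"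
    by (rule image_eqI[of _ _ "p * q"]) (simp_all add: pq assms polys_over_mult)
qed

lemma subring_poly_image_const:
  assumes "subring S" "x \<in> S"
  shows "x \<in> (\<lambda>p. poly p \<alpha>) ` polys_over S"
  by (rule image_eqI[of _ _ "[:x:]"]) (simp_all add: assms polys_over_pCons polys_over_0)

lemma subring_poly_image_self:
  assumes "subring S"
  shows "\<alpha> \<in> (\<lambda>p. poly p \<alpha>) ` polys_over S"
  by (rule image_eqI[of _ _ "[:0, 1:]"])
    (simp_all add: assms polys_over_pCons polys_over_0 subring_one subring_zero)

lemma countable_polys_over:
  assumes "countable S"
  shows "countable (polys_over S)"
proof (rule countable_subset)
  show "polys_over S \<subseteq> Poly ` lists S"
  proof
    fix p assume "p \<in> polys_over S"
    then have "coeffs p \<in> lists S"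
      by (auto simp: polys_over_def coeffs_def)
    then show "p \<in> Poly ` lists S"
      by (metis Poly_coeffs image_eqI)
  qed
qed (use assms in auto)

text \<open>There are countably many nonzero polynomials over \<open>S\<close>, each with finitely
  many roots, and these roots cannot exhaust the uncountable field.\<close>

lemma exists_transcendental:
  fixes S :: "complex set"
  assumes "countable S"
  obtains t where "\<And>p. p \<in> polys_over S \<Longrightarrow> poly p t = 0 \<Longrightarrow> p = 0"
proof -
  have "countable (\<Union>p\<in>polys_over S - {0}. {t. poly p t = 0})"
    by (intro countable_UN countable_Diff countable_polys_over assms)
      (auto intro: countable_finite poly_roots_finite)
  then have "(\<Union>p\<in>polys_over S - {0}. {t. poly p t = 0}) \<noteq> UNIV"
    using uncountable_UNIV_complex by auto
  then show ?thesis
    using that by auto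
qed

section \<open>Extending a derivation by one element\<close>

text \<open>
  The graph of a derivation \<open>S \<rightarrow> 'a\<close> is a subring of the dual numbers over \<open>'a\<close>. The value of
  \<open>extended D \<alpha> \<beta>\<close> at \<open>p\<close> is what an extension of \<open>D\<close> with \<open>D \<alpha> = \<beta>\<close> must take at \<open>p(\<alpha>)\<close>.
\<close>

definition extended :: "('a \<Rightarrow> 'a) \<Rightarrow> 'a \<Rightarrow> 'a \<Rightarrow> 'a poly \<Rightarrow> 'a::idom" where
  "extended D \<alpha> \<beta> p = poly (map_poly D p) \<alpha> + poly (pderiv p) \<alpha> * \<beta>"

context
  fixes S :: "'a::field_char_0 set" and D :: "'a \<Rightarrow> 'a"
  assumes S: "subring S"
    and D_diff: "\<And>x y. x \<in> S \<Longrightarrow> y \<in> S \<Longrightarrow> D (x - y) = D x - D y"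
    and D_mult: "\<And>x y. x \<in> S \<Longrightarrow> y \<in> S \<Longrightarrow> D (x * y) = x * D y + D x * y"
begin

lemma partial_zero: "D 0 = 0"
  using D_diff[of 0 0] subring_zero[OF S] by simp

lemma partial_add: "x \<in> S \<Longrightarrow> y \<in> S \<Longrightarrow> D (x + y) = D x + D y"
  using D_diff[of x "0 - y"] D_diff[of 0 y] subring_zero[OF S] subring_diff[OF S, of 0 y] partial_zero
  by simp

lemma partial_sum: "(\<And>i. i \<in> I \<Longrightarrow> f i \<in> S) \<Longrightarrow> D (\<Sum>i\<in>I. f i) = (\<Sum>i\<in>I. D (f i))"
  by (induction I rule: infinite_finite_induct)
    (auto simp: partial_zero partial_add subring_sum[OF S])

lemma coeff_map_poly_partial: "coeff (map_poly D p) i = D (coeff p i)"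
  by (simp add: coeff_map_poly partial_zero)

lemma extended_const: "extended D \<alpha> \<beta> [:a:] = D a"
  by (cases "a = 0") (simp_all add: extended_def map_poly_pCons partial_zero pderiv_pCons)

lemma extended_diff:
  assumes "p \<in> polys_over S" "q \<in> polys_over S"
  shows "extended D \<alpha> \<beta> (p - q) = extended D \<alpha> \<beta> p - extended D \<alpha> \<beta> q"
proof -
  have "map_poly D (p - q) = map_poly D p - map_poly D q"
    using assms by (intro poly_eqI) (simp add: coeff_map_poly_partial polys_over_def D_diff)
  then show ?thesis
    unfolding extended_def by (simp add: pderiv_diff left_diff_distrib)
qed

lemma extended_mult:
  assumes "p \<in> polys_over S" "q \<in> polys_over S"
  shows "extended D \<alpha> \<beta> (p * q) = poly p \<alpha> * extended D \<alpha> \<beta> q + extended D \<alpha> \<beta> p * poly q \<alpha>"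
proof -
  have "map_poly D (p * q) = p * map_poly D q + map_poly D p * q"
  proof (rule poly_eqI)
    fix i
    have "D (\<Sum>k\<le>i. coeff p k * coeff q (i - k)) =
        (\<Sum>k\<le>i. coeff p k * D (coeff q (i - k)) + D (coeff p k) * coeff q (i - k))"
      using assms by (subst partial_sum) (auto simp: polys_over_def D_mult intro: subring_mult[OF S])
    then show "coeff (map_poly D (p * q)) i = coeff (p * map_poly D q + map_poly D p * q) i"
      by (simp add: coeff_map_poly_partial coeff_mult sum.distrib)
  qed
  then show ?thesis
    by (simp add: extended_def pderiv_mult algebra_simps)
qed

text \<open>An extension to \<open>S\<close>[\<alpha>] is well defined exactly when it sends every
  algebraic relation of \<alpha> to 0. A relation of least degree determines \<beta>, and
  pseudo-division by it handles all the others.\<close>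

lemma partial_derivation_extension_value:
  obtains \<beta> where "\<And>p. p \<in> polys_over S \<Longrightarrow> poly p \<alpha> = 0 \<Longrightarrow> extended D \<alpha> \<beta> p = 0"
proof (cases "\<exists>p\<in>polys_over S. p \<noteq> 0 \<and> poly p \<alpha> = 0")
  case False
  \<comment> \<open>If only the zero polynomial vanishes at \<alpha>, every value is consistent; 0
    is an arbitrary choice.\<close>
  have "extended D \<alpha> 0 0 = 0"
    by (simp add: extended_def)
  then show ?thesis using False by (metis that)
next
  case True
  define P where "P = (\<lambda>p. p \<in> polys_over S \<and> p \<noteq> 0 \<and> poly p \<alpha> = 0)"
  obtain p0 where p0: "P p0" and min: "\<And>p. P p \<Longrightarrow> degree p0 \<le> degree p"
    using True ex_has_least_nat[of P _ degree] unfolding P_def by (metis (no_types, lifting))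
  have deg0: "degree p0 > 0"
  proof (rule ccontr)
    assume "\<not> degree p0 > 0"
    then obtain a where "p0 = [:a:]" by (auto elim: degree_eq_zeroE)
    then show False using p0 by (auto simp: P_def)
  qed
  \<comment> \<open>In characteristic 0 the derivative of \<open>p0\<close> is a nonzero polynomial
    of smaller degree, so a root at \<alpha> would contradict minimality.\<close>
  have deriv0: "poly (pderiv p0) \<alpha> \<noteq> 0"
  proof
    assume "poly (pderiv p0) \<alpha> = 0"
    moreover have "pderiv p0 \<noteq> 0" using deg0 by (simp add: pderiv_eq_0_iff)
    ultimately have "P (pderiv p0)"
      using p0 by (simp add: P_def polys_over_pderiv[OF S])
    from min[OF this] deg0 show False by (simp add: degree_pderiv)
  qed
  \<comment> \<open>This solves the linear equation
    \<open>extended D \<alpha> \<beta> p0 = 0\<close> for \<beta>.\<close>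
  define \<beta> where "\<beta> = - poly (map_poly D p0) \<alpha> / poly (pderiv p0) \<alpha>"
  have ext0: "extended D \<alpha> \<beta> p0 = 0"
    using deriv0 by (simp add: extended_def \<beta>_def)
  have "extended D \<alpha> \<beta> p = 0" if "p \<in> polys_over S" "poly p \<alpha> = 0" for p
    using that
  proof (induction "degree p" arbitrary: p rule: less_induct)
    case (less p)
    show ?case
    proof (cases "degree p < degree p0")
      case True
      then have "p = 0" using min[of p] less.prems by (auto simp: P_def)
      then show ?thesis by (simp add: extended_def)
    next
      case False
      define l where "l = lead_coeff p0"
      define q where "q = monom (lead_coeff p) (degree p - degree p0)"
      have l: "l \<in> S" "l \<noteq> 0" using p0 by (auto simp: l_def P_def polys_over_def)
      have p0S: "p0 \<in> polys_over S" "poly p0 \<alpha> = 0" "p0 \<noteq> 0" using p0 by (auto simp: P_def)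
      have lS: "[:l:] \<in> polys_over S"
        using l S by (simp add: polys_over_pCons polys_over_0)
      have qS: "q \<in> polys_over S"
        using less.prems unfolding q_def by (intro polys_over_monom[OF S]) (simp add: polys_over_def)
      \<comment> \<open>Since \<open>S\<close> need not be a field, \<open>p\<close> is first
        multiplied by the leading coefficient of \<open>p0\<close>; then the leading terms
        cancel.\<close>
      define r where "r = [:l:] * p - q * p0"
      have rS: "r \<in> polys_over S"
        unfolding r_def by (intro polys_over_diff[OF S] polys_over_mult[OF S] lS qS p0S less.prems)
      have r\<alpha>: "poly r \<alpha> = 0" using less.prems p0S by (simp add: r_def)
      have "extended D \<alpha> \<beta> r = 0"
      proof (cases "p = 0")
        case True
        then show ?thesis by (simp add: r_def q_def extended_def)
      next
        case pn: False
        have "degree p > 0" using deg0 False by simp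
        have "q \<noteq> 0" "degree q = degree p - degree p0" "lead_coeff q = lead_coeff p"
          using pn by (auto simp: q_def degree_monom_eq monom_eq_0_iff)
        then have dq: "degree (q * p0) = degree p" "lead_coeff (q * p0) = lead_coeff p * l"
          using p0S False by (simp_all only: lead_coeff_mult l_def) (simp add: degree_mult_eq)
        have dl: "degree ([:l:] * p) = degree p" using l by simp
        have "coeff r (degree p) = 0"
          using dq by (simp add: r_def del: coeff_mult)
        moreover have "degree r \<le> degree p"
          unfolding r_def using degree_diff_le[of "[:l:] * p" "degree p" "q * p0"] dq(1) dl by simp
        ultimately have "degree r < degree p"
          using \<open>degree p > 0\<close> by (metis degree_0 le_neq_implies_less leading_coeff_0_iff)
        then show ?thesis using less.hyps rS r\<alpha> by blast
      qed
      \<comment> \<open>By the product rule \<open>q * p0\<close> contributes nothing, as both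
        \<open>p0\<close> and its extended value vanish at \<alpha>. The term with
        \<open>D l\<close> carries the factor \<open>poly p \<alpha> = 0\<close>.\<close>
      moreover have "extended D \<alpha> \<beta> r = l * extended D \<alpha> \<beta> p"
        using less.prems p0S unfolding r_def
        by (simp only: extended_diff extended_mult polys_over_mult[OF S] lS qS ext0 extended_const) simp
      ultimately show ?thesis using l by simp
    qed
  qed
  then show ?thesis using that by blast
qed

end

section \<open>Extending derivations to the whole field\<close>

text \<open>With partial derivations stored as sets of pairs, extension is inclusion and chains have
  unions. Together with closure under differences, the last clause makes the relation
  single-valued.\<close>

definition derivation_graph :: "('a::idom \<times> 'a) set \<Rightarrow> bool" where
  "derivation_graph G \<longleftrightarrow> (1, 0) \<in> G \<and>
     (\<forall>a a' b b'. (a, a') \<in> G \<longrightarrow> (b, b') \<in> G \<longrightarrow> (a - b, a' - b') \<in> G \<and> (a * b, a * b' + a' * b) \<in> G) \<and>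
     (\<forall>b. (0, b) \<in> G \<longrightarrow> b = 0)"

lemma derivation_graph_closed:
  assumes "derivation_graph G" "(a, a') \<in> G" "(b, b') \<in> G"
  shows "(a - b, a' - b') \<in> G \<and> (a * b, a * b' + a' * b) \<in> G"
proof -
  have "\<forall>a a' b b'. (a, a') \<in> G \<longrightarrow> (b, b') \<in> G \<longrightarrow>
      (a - b, a' - b') \<in> G \<and> (a * b, a * b' + a' * b) \<in> G"
    using assms(1) unfolding derivation_graph_def by (elim conjE)
  then show ?thesis
    using assms(2,3) by (elim allE impE)
qed

lemmas derivation_graph_diff = derivation_graph_closed[THEN conjunct1]
  and derivation_graph_mult = derivation_graph_closed[THEN conjunct2]

lemma derivation_graph_unique:
  assumes "derivation_graph G" "(a, a') \<in> G" "(a, b') \<in> G"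
  shows "a' = b'"
proof -
  have "(0, a' - b') \<in> G" using derivation_graph_diff[OF assms] by simp
  then have "a' - b' = 0" using assms(1)[unfolded derivation_graph_def] by metis
  then show ?thesis by simp
qed

text \<open>The domain of \<open>G\<close> is a subring and \<open>G\<close> is the graph of a
  derivation on it; the new graph lives over the ring obtained by adjoining \<alpha>.\<close>

lemma derivation_graph_extend:
  fixes G :: "('a::field_char_0 \<times> 'a) set"
  assumes G: "derivation_graph G"
  obtains H where "derivation_graph H" "G \<subseteq> H" "\<alpha> \<in> fst ` H"
proof -
  define D where "D = (\<lambda>a. THE a'. (a, a') \<in> G)"
  define S where "S = fst ` G"
  have D_eq: "D a = a'" if "(a, a') \<in> G" for a a'
    unfolding D_def using that derivation_graph_unique[OF G] by blast
  have DG: "(a, D a) \<in> G" if "a \<in> S" for a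
    using that D_eq by (auto simp: S_def)
  have step: "(a - b, D a - D b) \<in> G" "(a * b, a * D b + D a * b) \<in> G" if "a \<in> S" "b \<in> S" for a b
    using derivation_graph_diff[OF G DG DG] derivation_graph_mult[OF G DG DG] that by blast+
  have S: "subring S"
    unfolding subring_def
  proof (intro conjI ballI)
    show "1 \<in> S" using G by (force simp: S_def derivation_graph_def)
  qed (use step in \<open>force simp: S_def\<close>)+
  have D_diff: "\<And>x y. x \<in> S \<Longrightarrow> y \<in> S \<Longrightarrow> D (x - y) = D x - D y"
    and D_mult: "\<And>x y. x \<in> S \<Longrightarrow> y \<in> S \<Longrightarrow> D (x * y) = x * D y + D x * y"
    using step D_eq by blast+
  obtain \<beta> where \<beta>: "\<And>p. p \<in> polys_over S \<Longrightarrow> poly p \<alpha> = 0 \<Longrightarrow> extended D \<alpha> \<beta> p = 0"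
    using partial_derivation_extension_value[OF S D_diff D_mult] by blast
  define H where "H = (\<lambda>p. (poly p \<alpha>, extended D \<alpha> \<beta> p)) ` polys_over S"
  have const: "[:a:] \<in> polys_over S" if "a \<in> S" for a
    using that S by (simp add: polys_over_pCons polys_over_0)
  have ext_const: "extended D \<alpha> \<beta> [:a:] = D a" for a
    by (rule extended_const[OF S D_diff D_mult])
  have "G \<subseteq> H"
  proof
    fix x assume "x \<in> G"
    then show "x \<in> H" unfolding H_def
      using D_eq[of "fst x" "snd x"] by (intro image_eqI[of _ _ "[:fst x:]"] const) (auto simp: ext_const S_def)
  qed
  moreover have "\<alpha> \<in> fst ` H"
    using subring_poly_image_self[OF S, of \<alpha>] by (force simp: H_def)
  moreover have "derivation_graph H"
    unfolding derivation_graph_def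
  proof (intro conjI allI impI)
    show "(1, 0) \<in> H" using \<open>G \<subseteq> H\<close> G by (auto simp: derivation_graph_def)
  next
    \<comment> \<open>This is where the choice of \<beta> enters: a polynomial with value 0 at
      \<alpha> also has extended value 0.\<close>
    fix b assume "(0, b) \<in> H" then show "b = 0" using \<beta> by (auto simp: H_def)
  next
    fix a a' b b' assume "(a, a') \<in> H" "(b, b') \<in> H"
    then obtain p q where pq: "p \<in> polys_over S" "q \<in> polys_over S"
      and "a = poly p \<alpha>" "a' = extended D \<alpha> \<beta> p" "b = poly q \<alpha>" "b' = extended D \<alpha> \<beta> q"
      by (auto simp: H_def)
    moreover have "(poly (p - q) \<alpha>, extended D \<alpha> \<beta> (p - q)) \<in> H" "(poly (p * q) \<alpha>, extended D \<alpha> \<beta> (p * q)) \<in> H"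
      unfolding H_def by (intro imageI polys_over_diff[OF S] polys_over_mult[OF S] pq)+
    ultimately show "(a - b, a' - b') \<in> H" "(a * b, a * b' + a' * b) \<in> H"
      by (simp_all add: extended_diff[OF S D_diff D_mult pq] extended_mult[OF S D_diff D_mult pq])
  qed
  ultimately show ?thesis using that by blast
qed

text \<open>Zorn's lemma gives a maximal graph above \<open>G\<close>. It is defined everywhere,
  because any missing element could still be adjoined.\<close>

lemma derivation_graph_maximal:
  fixes G :: "('a::field_char_0 \<times> 'a) set"
  assumes G: "derivation_graph G"
  obtains \<delta> where "derivation \<delta>" "\<And>a a'. (a, a') \<in> G \<Longrightarrow> \<delta> a = a'"
proof -
  define A where "A = {H. derivation_graph H \<and> G \<subseteq> H}"
  have "\<exists>M\<in>A. \<forall>X\<in>A. M \<subseteq> X \<longrightarrow> X = M"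
  proof (rule subset_Zorn_nonempty)
    show "A \<noteq> {}" using G by (auto simp: A_def)
  next
    fix C assume "C \<noteq> {}" and ch: "subset.chain A C"
    have CA: "derivation_graph H" "G \<subseteq> H" if "H \<in> C" for H
      using ch that by (auto simp: subset.chain_def A_def)
    have "derivation_graph (\<Union>C)"
      unfolding derivation_graph_def
    proof (intro conjI allI impI)
      show "(1, 0) \<in> \<Union>C" using \<open>C \<noteq> {}\<close> CA(1) by (auto simp: derivation_graph_def)
    next
      fix b assume "(0, b) \<in> \<Union>C" then show "b = 0" using CA(1) by (auto simp: derivation_graph_def)
    next
      fix a a' b b' assume "(a, a') \<in> \<Union>C" "(b, b') \<in> \<Union>C"
      then obtain X Y where XY: "X \<in> C" "(a, a') \<in> X" "Y \<in> C" "(b, b') \<in> Y" by auto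
      then have "X \<subseteq> Y \<or> Y \<subseteq> X" using ch by (auto simp: subset.chain_def)
      then obtain Z where "Z \<in> C" "(a, a') \<in> Z" "(b, b') \<in> Z" using XY(1-4) by (elim disjE) auto
      then have "(a - b, a' - b') \<in> Z" "(a * b, a * b' + a' * b) \<in> Z"
        using CA(1) by (blast intro: derivation_graph_diff derivation_graph_mult)+
      then show "(a - b, a' - b') \<in> \<Union>C" "(a * b, a * b' + a' * b) \<in> \<Union>C"
        using \<open>Z \<in> C\<close> by auto
    qed
    then show "\<Union>C \<in> A" using \<open>C \<noteq> {}\<close> CA(2) by (auto simp: A_def)
  qed
  then obtain M where M: "derivation_graph M" "G \<subseteq> M"
    and max: "\<And>X. derivation_graph X \<Longrightarrow> M \<subseteq> X \<Longrightarrow> X = M"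
    by (auto simp: A_def)
  \<comment> \<open>The extension of \<open>M\<close> to \<alpha> equals \<open>M\<close> by
    maximality, so \<alpha> was in the domain already.\<close>
  have total: "\<alpha> \<in> fst ` M" for \<alpha>
    by (rule derivation_graph_extend[OF M(1), of \<alpha>]) (use max in blast)
  define \<delta> where "\<delta> = (\<lambda>a. THE a'. (a, a') \<in> M)"
  have \<delta>_eq: "\<delta> a = a'" if "(a, a') \<in> M" for a a'
    unfolding \<delta>_def using that derivation_graph_unique[OF M(1)] by blast
  have \<delta>M: "(a, \<delta> a) \<in> M" for a
    using total[of a] \<delta>_eq by auto
  have diff: "(a - b, \<delta> a - \<delta> b) \<in> M" and mult: "(a * b, a * \<delta> b + \<delta> a * b) \<in> M" for a b
    by (rule derivation_graph_diff[OF M(1) \<delta>M \<delta>M], rule derivation_graph_mult[OF M(1) \<delta>M \<delta>M])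
  have \<delta>_diff: "\<delta> (a - b) = \<delta> a - \<delta> b" for a b by (rule \<delta>_eq[OF diff])
  have "\<delta> (a + b) = \<delta> a + \<delta> b" for a b
    using \<delta>_diff[of "a + b" b] by simp
  then have "derivation \<delta>"
    using \<delta>_eq[OF mult] by unfold_locales
  moreover have "\<delta> a = a'" if "(a, a') \<in> G" for a a'
    using that M(2) \<delta>_eq by blast
  ultimately show ?thesis using that by blast
qed

section \<open>Derivations dual to independent numbers\<close>

text \<open>Formal differentiation with respect to \<open>t\<close> is well defined on
  \<open>S\<close>[t], because only the zero polynomial over \<open>S\<close> vanishes at
  \<open>t\<close>; it then extends to the whole field.\<close>

lemma derivation_of_transcendental:
  fixes S :: "'a::field_char_0 set"
  assumes S: "subring S" and t: "\<And>p. p \<in> polys_over S \<Longrightarrow> poly p t = 0 \<Longrightarrow> p = 0"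
  obtains \<delta> where "derivation \<delta>" "\<And>a. a \<in> S \<Longrightarrow> \<delta> a = 0" "\<delta> t = 1"
proof -
  define G where "G = (\<lambda>p. (poly p t, poly (pderiv p) t)) ` polys_over S"
  have mem: "(poly p t, poly (pderiv p) t) \<in> G" if "p \<in> polys_over S" for p
    using that by (auto simp: G_def)
  have const: "(a, 0) \<in> G" if "a \<in> S" for a
    using mem[of "[:a:]"] that S by (simp add: polys_over_pCons polys_over_0 pderiv_pCons)
  have t1: "(t, 1) \<in> G"
    using mem[of "[:0, 1:]"] S by (simp add: polys_over_pCons polys_over_0 pderiv_pCons subring_one subring_zero)
  have "derivation_graph G"
    unfolding derivation_graph_def
  proof (intro conjI allI impI)
    show "(1, 0) \<in> G" using const S by (simp add: subring_one)
  next
    fix b assume "(0, b) \<in> G"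
    then obtain p where "p \<in> polys_over S" "poly p t = 0" "b = poly (pderiv p) t" by (auto simp: G_def)
    then show "b = 0" using t[of p] by simp
  next
    fix a a' b b' assume "(a, a') \<in> G" "(b, b') \<in> G"
    then obtain p q where pq: "p \<in> polys_over S" "q \<in> polys_over S"
      and ab: "a = poly p t" "a' = poly (pderiv p) t" "b = poly q t" "b' = poly (pderiv q) t"
      by (auto simp: G_def)
    show "(a - b, a' - b') \<in> G" "(a * b, a * b' + a' * b) \<in> G"
      using mem[OF polys_over_diff[OF S pq]] mem[OF polys_over_mult[OF S pq]]
      by (simp_all add: ab pderiv_diff pderiv_mult algebra_simps)
  qed
  then obtain \<delta> where "derivation \<delta>" "\<And>a a'. (a, a') \<in> G \<Longrightarrow> \<delta> a = a'"
    using derivation_graph_maximal by blast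
  then show ?thesis using that const t1 by blast
qed

lemma countable_subring_adjoin:
  fixes S :: "'a::idom set"
  assumes "countable S" "subring S"
  obtains S' where "countable S'" "subring S'" "S \<subseteq> S'" "t \<in> S'"
proof
  show "countable ((\<lambda>p. poly p t) ` polys_over S)"
    using assms by (simp add: countable_polys_over)
  show "S \<subseteq> (\<lambda>p. poly p t) ` polys_over S"
    using subring_poly_image_const[OF assms(2)] by blast
qed (intro subring_poly_image subring_poly_image_self assms(2))+

lemma countable_subring_containing:
  fixes A :: "'a::idom set"
  assumes "finite A"
  obtains S where "countable S" "subring S" "A \<subseteq> S"
proof -
  have "\<exists>S. countable S \<and> subring S \<and> A \<subseteq> S"
    using assms
  proof (induction A)
    case empty
    have "countable (range of_int :: 'a set)" by simp
    moreover have "subring (range of_int :: 'a set)"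
      unfolding subring_def by (auto simp flip: of_int_diff of_int_mult) (metis of_int_1 rangeI)
    ultimately show ?case by blast
  next
    case (insert x A)
    then obtain S where "countable S" "subring S" "A \<subseteq> S" by blast
    moreover from this obtain S' where "countable S'" "subring S'" "S \<subseteq> S'" "x \<in> S'"
      using countable_subring_adjoin by blast
    ultimately show ?case by blast
  qed
  then show ?thesis using that by blast
qed

text \<open>The construction is triangular: a transcendental \<open>u\<close> is adjoined before the
  remaining numbers are chosen, so their derivations kill \<open>u\<close>, and only the derivation
  belonging to \<open>u\<close> needs a correction.\<close>

lemma independent_derivations:
  fixes S :: "complex set"
  assumes "countable S" "subring S"
  obtains t :: "nat \<Rightarrow> complex" and D :: "nat \<Rightarrow> complex \<Rightarrow> complex"
  where "\<And>i. i < N \<Longrightarrow> derivation (D i)"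
    and "\<And>i a. i < N \<Longrightarrow> a \<in> S \<Longrightarrow> D i a = 0"
    and "\<And>i j. i < N \<Longrightarrow> j < N \<Longrightarrow> D i (t j) = of_bool (i = j)"
proof -
  have "\<exists>t D. (\<forall>i<N. derivation (D i)) \<and> (\<forall>i<N. \<forall>a\<in>S. D i a = 0) \<and>
      (\<forall>i<N. \<forall>j<N. D i (t j) = (of_bool (i = j) :: complex))"
    using assms
  proof (induction N arbitrary: S)
    case (Suc N)
    obtain u where u: "\<And>p. p \<in> polys_over S \<Longrightarrow> poly p u = 0 \<Longrightarrow> p = 0"
      using exists_transcendental[OF Suc.prems(1)] by blast
    obtain \<delta> where \<delta>: "derivation \<delta>" "\<And>a. a \<in> S \<Longrightarrow> \<delta> a = 0" "\<delta> u = 1"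
      using derivation_of_transcendental[OF Suc.prems(2) u] by blast
    obtain S' where S': "countable S'" "subring S'" "S \<subseteq> S'" "u \<in> S'"
      using countable_subring_adjoin[OF Suc.prems] by blast
    obtain t D where D: "\<forall>i<N. derivation (D i)" "\<forall>i<N. \<forall>a\<in>S'. D i a = 0"
      "\<forall>i<N. \<forall>j<N. D i (t j) = (of_bool (i = j) :: complex)"
      using Suc.IH[OF S'(1,2)] by blast
    \<comment> \<open>Subtracting these multiples of the \<open>D j\<close> makes the derivation
      vanish on every \<open>t j\<close>. The values on \<open>S\<close> and at \<open>u\<close>
      stay the same, since all \<open>D j\<close> kill \<open>S'\<close>.\<close>
    define \<delta>' where "\<delta>' = (\<lambda>x. \<delta> x - (\<Sum>j<N. \<delta> (t j) * D j x))"
    have "derivation \<delta>'"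
    proof
      fix x y
      show "\<delta>' (x + y) = \<delta>' x + \<delta>' y"
        using D(1) \<delta>(1) by (simp add: \<delta>'_def derivation.add sum.distrib algebra_simps)
      have "(\<Sum>j<N. \<delta> (t j) * D j (x * y)) =
          (\<Sum>j<N. x * (\<delta> (t j) * D j y) + \<delta> (t j) * D j x * y)"
        using D(1) by (intro sum.cong) (auto simp: derivation.mult algebra_simps)
      also have "\<dots> = x * (\<Sum>j<N. \<delta> (t j) * D j y) + (\<Sum>j<N. \<delta> (t j) * D j x) * y"
        by (simp add: sum.distrib sum_distrib_left sum_distrib_right)
      finally show "\<delta>' (x * y) = x * \<delta>' y + \<delta>' x * y"
        using \<delta>(1) by (simp add: \<delta>'_def derivation.mult algebra_simps)
    qed
    moreover have "\<delta>' a = 0" if "a \<in> S" for a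
      using that S'(3) \<delta>(2) D(2) by (auto simp: \<delta>'_def intro!: sum.neutral)
    moreover have "\<delta>' u = 1"
      using S'(4) \<delta>(3) D(2) by (simp add: \<delta>'_def)
    moreover have "\<delta>' (t j) = 0" if "j < N" for j
      using that D(3) by (simp add: \<delta>'_def if_distrib[of "\<lambda>x. _ * x"] of_bool_def sum.delta cong: if_cong)
    ultimately show ?case
      \<comment> \<open>The new number and its derivation get index 0; the old ones move up by
        one.\<close>
      using D S'(3,4) by (intro exI[of _ "case_nat u t"] exI[of _ "case_nat \<delta>' D"])
        (auto split: nat.splits simp: less_Suc_eq_0_disj)
  qed simp
  then show ?thesis using that by blast
qed

section \<open>Polynomials: evaluation, substitution and partial derivatives\<close>

abbreviation "lookup \<equiv> Poly_Mapping.lookup"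
abbreviation "keys \<equiv> Poly_Mapping.keys"
abbreviation "single \<equiv> Poly_Mapping.single"

lemma poly_mapping_sum_singles: "(\<Sum>m\<in>keys p. single m (lookup p m)) = p"
proof (rule poly_mapping_eqI)
  fix k
  show "lookup (\<Sum>m\<in>keys p. single m (lookup p m)) k = lookup p k"
    by (simp add: lookup_sum lookup_single when_def in_keys_iff)
qed

lemma poly_mapping_single_induct:
  assumes "\<And>m c. P (single m c)" "\<And>p q. P p \<Longrightarrow> P q \<Longrightarrow> P (p + q)"
  shows "P (p :: 'a \<Rightarrow>\<^sub>0 'b::comm_monoid_add)"
proof -
  have "P 0" using assms(1)[of undefined 0] by simp
  then have "P (\<Sum>m\<in>I. single m (lookup p m))" for I
    by (induction I rule: infinite_finite_induct) (use assms in auto)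
  from this[of "keys p"] show ?thesis by (simp only: poly_mapping_sum_singles)
qed

section \<open>Evaluation and substitution as homomorphisms\<close>

definition monom_val :: "(cox_var \<Rightarrow> 'b::comm_semiring_1) \<Rightarrow> (cox_var \<Rightarrow>\<^sub>0 nat) \<Rightarrow> 'b" where
  "monom_val f m = (\<Prod>v\<in>keys m. f v ^ lookup m v)"

lemma monom_val_superset:
  assumes "finite W" "keys m \<subseteq> W"
  shows "monom_val f m = (\<Prod>v\<in>W. f v ^ lookup m v)"
  unfolding monom_val_def using assms by (intro prod.mono_neutral_left) (auto simp: in_keys_iff)

lemma monom_val_zero [simp]: "monom_val f 0 = 1"
  by (simp add: monom_val_def)

lemma monom_val_single [simp]: "monom_val f (single v n) = f v ^ n"
  by (simp add: monom_val_def)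

lemma monom_val_add: "monom_val f (m + m') = monom_val f m * monom_val f m'"
proof -
  have W: "finite (keys m \<union> keys m')" "keys (m + m') \<subseteq> keys m \<union> keys m'"
    by (simp_all add: Poly_Mapping.keys_add)
  have "monom_val f (m + m') = (\<Prod>v\<in>keys m \<union> keys m'. f v ^ lookup m v * f v ^ lookup m' v)"
    by (simp add: monom_val_superset[OF W] lookup_add power_add)
  then show ?thesis
    by (simp add: prod.distrib monom_val_superset[of "keys m \<union> keys m'"])
qed

text \<open>The two instances are evaluation, with \<open>h = id\<close>, and substitution, with
  \<open>h = PConst\<close>; every rule proved here serves both.\<close>

locale scalar_hom =
  fixes h :: "complex \<Rightarrow> 'b::comm_ring_1"
  assumes scalar_zero: "h 0 = 0" and scalar_one: "h 1 = 1"
    and scalar_add: "h (x + y) = h x + h y" and scalar_mult: "h (x * y) = h x * h y"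
begin

lemma poly_hom_single: "poly_hom h f (single m c) = h c * monom_val f m"
  by (simp add: poly_hom_def monom_val_def scalar_zero)

lemma poly_hom_zero: "poly_hom h f 0 = 0"
  by (simp add: poly_hom_def)

lemma poly_hom_add: "poly_hom h f (p + q) = poly_hom h f p + poly_hom h f q"
  unfolding poly_hom_def
  by (rule setsum_keys_plus_distrib) (simp_all add: scalar_zero scalar_add distrib_right)

lemma poly_hom_mult: "poly_hom h f (p * q) = poly_hom h f p * poly_hom h f q"
proof (induction p rule: poly_mapping_single_induct)
  case (1 m c)
  show ?case
    by (induction q rule: poly_mapping_single_induct)
      (simp_all add: mult_single poly_hom_single monom_val_add scalar_mult poly_hom_add algebra_simps)
qed (simp add: poly_hom_add algebra_simps)

lemma poly_hom_PConst: "poly_hom h f (PConst c) = h c"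
  by (simp add: PConst_def poly_hom_single)

lemma poly_hom_one: "poly_hom h f 1 = 1"
  using poly_hom_PConst[of f 1] by (simp add: PConst_def scalar_one)

lemma poly_hom_PVar: "poly_hom h f (PVar v) = f v"
  by (simp add: PVar_def poly_hom_single scalar_one)

lemma poly_hom_minus: "poly_hom h f (- p) = - poly_hom h f p"
  using poly_hom_add[of f p "- p"] by (simp add: poly_hom_zero add_eq_0_iff2)

lemma poly_hom_diff: "poly_hom h f (p - q) = poly_hom h f p - poly_hom h f q"
  using poly_hom_add[of f p "- q"] by (simp add: poly_hom_minus)

lemma poly_hom_sum: "poly_hom h f (\<Sum>i\<in>I. g i) = (\<Sum>i\<in>I. poly_hom h f (g i))"
  by (induction I rule: infinite_finite_induct) (simp_all add: poly_hom_zero poly_hom_add)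

lemma poly_hom_power: "poly_hom h f (p ^ n) = poly_hom h f p ^ n"
  by (induction n) (simp_all add: poly_hom_one poly_hom_mult)

end

lemma PConst_zero [simp]: "PConst 0 = 0" and PConst_one [simp]: "PConst 1 = 1"
  and PConst_add: "PConst (x + y) = PConst x + PConst y"
  and PConst_mult: "PConst (x * y) = PConst x * PConst y"
  by (simp_all add: PConst_def single_add mult_single)

interpretation eval_hom: scalar_hom "id :: complex \<Rightarrow> complex"
  by unfold_locales simp_all

interpretation subst_hom: scalar_hom PConst
  by unfold_locales (simp_all add: PConst_add PConst_mult)

lemmas peval_simps [simp] =
  eval_hom.poly_hom_zero[folded peval_def] eval_hom.poly_hom_one[folded peval_def]
  eval_hom.poly_hom_PVar[folded peval_def] eval_hom.poly_hom_PConst[folded peval_def, simplified]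
  eval_hom.poly_hom_add[folded peval_def] eval_hom.poly_hom_mult[folded peval_def]
  eval_hom.poly_hom_diff[folded peval_def] eval_hom.poly_hom_sum[folded peval_def]
  eval_hom.poly_hom_power[folded peval_def]

lemmas psubst_simps [simp] =
  subst_hom.poly_hom_zero[folded psubst_def] subst_hom.poly_hom_one[folded psubst_def]
  subst_hom.poly_hom_PVar[folded psubst_def] subst_hom.poly_hom_PConst[folded psubst_def]
  subst_hom.poly_hom_add[folded psubst_def] subst_hom.poly_hom_mult[folded psubst_def]
  subst_hom.poly_hom_diff[folded psubst_def] subst_hom.poly_hom_sum[folded psubst_def]
  subst_hom.poly_hom_power[folded psubst_def]

lemma monom_val_PVar: "monom_val PVar m = single m 1"
proof (induction m rule: poly_mapping_single_induct)
  case (1 v n)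
  show ?case
    by (induction n) (simp_all add: PVar_def mult_single flip: single_add)
qed (simp add: monom_val_add mult_single)

lemma single_eq_monomial: "single m c = PConst c * (\<Prod>v\<in>keys m. PVar v ^ lookup m v)"
  using monom_val_PVar[of m] by (simp add: monom_val_def PConst_def mult_single)

text \<open>The set \<open>K\<close> restricts the coefficients that the induction has to treat. The
  chain rule takes for it the constants of a derivation; elsewhere it is
  \<open>UNIV\<close>.\<close>

lemma polys_in_induct:
  assumes "p \<in> polys_in V"
    and coeffs: "\<And>m. lookup p m \<in> K" and K1: "1 \<in> K"
    and const: "\<And>c. c \<in> K \<Longrightarrow> P (PConst c)"
    and var: "\<And>v. v \<in> V \<Longrightarrow> P (PVar v)"
    and add: "\<And>p q. P p \<Longrightarrow> P q \<Longrightarrow> P (p + q)"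
    and mult: "\<And>p q. P p \<Longrightarrow> P q \<Longrightarrow> P (p * q)"
    and zero: "P 0"
  shows "P p"
proof -
  have P1: "P 1" using const[OF K1] by simp
  have pow: "P (PVar v ^ n)" if "v \<in> V" for v n
    by (induction n) (use P1 mult var that in auto)
  have prod: "P (\<Prod>v\<in>W. PVar v ^ lookup m v)" if "W \<subseteq> V" for W and m :: "cox_var \<Rightarrow>\<^sub>0 nat"
    using that by (induction W rule: infinite_finite_induct) (use P1 mult pow in auto)
  have "P (\<Sum>m\<in>M. single m (lookup p m))" if "M \<subseteq> keys p" for M
    using that
  proof (induction M rule: infinite_finite_induct)
    case (insert m M)
    have "keys m \<subseteq> V" using insert.prems assms(1) by (auto simp: polys_in_def)
    then have "P (single m (lookup p m))"
      unfolding single_eq_monomial by (intro mult const coeffs prod)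
    then show ?case using insert by (auto intro: add)
  qed (use zero in auto)
  from this[of "keys p"] show ?thesis by (simp add: poly_mapping_sum_singles)
qed

lemma polys_in_UNIV: "p \<in> polys_in UNIV"
  by (simp add: polys_in_def)

lemma cpoly_induct [case_names const var add mult]:
  assumes "\<And>c. P (PConst c)" "\<And>v. P (PVar v)"
    and "\<And>p q. P p \<Longrightarrow> P q \<Longrightarrow> P (p + q)" "\<And>p q. P p \<Longrightarrow> P q \<Longrightarrow> P (p * q)"
  shows "P p"
  by (rule polys_in_induct[OF polys_in_UNIV, where K = UNIV])
    (use assms assms(1)[of 0] in auto)

lemma polys_in_mono: "V \<subseteq> W \<Longrightarrow> polys_in V \<subseteq> polys_in W"
  by (auto simp: polys_in_def)

lemma polys_in_PConst [simp]: "PConst c \<in> polys_in V"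
  by (simp add: polys_in_def PConst_def)

lemma polys_in_zero [simp]: "0 \<in> polys_in V" and polys_in_one [simp]: "1 \<in> polys_in V"
  using polys_in_PConst[of 0 V] polys_in_PConst[of 1 V] by simp_all

lemma polys_in_PVar [simp]: "PVar v \<in> polys_in V \<longleftrightarrow> v \<in> V"
  by (simp add: polys_in_def PVar_def)

lemma polys_in_add: "p \<in> polys_in V \<Longrightarrow> q \<in> polys_in V \<Longrightarrow> p + q \<in> polys_in V"
  using Poly_Mapping.keys_add[of p q] unfolding polys_in_def by blast

lemma polys_in_mult: "p \<in> polys_in V \<Longrightarrow> q \<in> polys_in V \<Longrightarrow> p * q \<in> polys_in V"
proof -
  assume pq: "p \<in> polys_in V" "q \<in> polys_in V"
  have "keys m \<subseteq> V" if m: "m \<in> keys (p * q)" for m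
  proof -
    from m obtain a b where "m = a + b" "a \<in> keys p" "b \<in> keys q"
      using Poly_Mapping.keys_mult[of p q] by blast
    then show ?thesis
      using pq Poly_Mapping.keys_add[of a b] unfolding polys_in_def by blast
  qed
  then show ?thesis by (simp add: polys_in_def)
qed

lemma polys_in_diff: "p \<in> polys_in V \<Longrightarrow> q \<in> polys_in V \<Longrightarrow> p - q \<in> polys_in V"
  using Poly_Mapping.keys_diff[of p q] unfolding polys_in_def by blast

lemma polys_in_power: "p \<in> polys_in V \<Longrightarrow> p ^ n \<in> polys_in V"
  by (induction n) (auto intro: polys_in_mult)

lemma polys_in_sum: "(\<And>i. i \<in> I \<Longrightarrow> f i \<in> polys_in V) \<Longrightarrow> (\<Sum>i\<in>I. f i) \<in> polys_in V"
  by (induction I rule: infinite_finite_induct) (auto intro: polys_in_add)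

lemma polys_in_psubst:
  assumes "p \<in> polys_in V" "\<And>v. v \<in> V \<Longrightarrow> \<sigma> v \<in> polys_in W"
  shows "psubst \<sigma> p \<in> polys_in W"
  using assms(1) by (rule polys_in_induct[where K = UNIV])
    (auto intro: assms(2) polys_in_add polys_in_mult)

lemma psubst_cong:
  assumes "p \<in> polys_in V" "\<And>v. v \<in> V \<Longrightarrow> \<sigma> v = \<tau> v"
  shows "psubst \<sigma> p = psubst \<tau> p"
  using assms(1) by (rule polys_in_induct[where K = UNIV]) (auto simp: assms(2))

lemma peval_cong:
  assumes "p \<in> polys_in V" "\<And>v. v \<in> V \<Longrightarrow> u v = u' v"
  shows "peval u p = peval u' p"
  using assms(1) by (rule polys_in_induct[where K = UNIV]) (auto simp: assms(2))

lemma psubst_psubst: "psubst \<sigma> (psubst \<tau> p) = psubst (\<lambda>v. psubst \<sigma> (\<tau> v)) p"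
  by (induction p rule: cpoly_induct) simp_all

lemma psubst_PVar [simp]: "psubst PVar p = p"
  by (induction p rule: cpoly_induct) simp_all

lemma peval_psubst: "peval u (psubst \<sigma> p) = peval (\<lambda>v. peval u (\<sigma> v)) p"
  by (induction p rule: cpoly_induct) simp_all

lemma pdiff_single: "pdiff v (single m c) = single (m - single v 1) (of_nat (lookup m v) * c)"
  by (simp add: pdiff_def)

lemma pdiff_add: "pdiff v (p + q) = pdiff v p + pdiff v q"
  unfolding pdiff_def by (rule setsum_keys_plus_distrib) (simp_all add: single_add distrib_left)

lemma lookup_positive_decompose:
  assumes "lookup m v \<noteq> (0::nat)"
  shows "m - single v 1 + single v 1 = m"
  by (rule poly_mapping_eqI) (use assms in \<open>auto simp: lookup_add lookup_minus lookup_single when_def\<close>)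

text \<open>By bilinearity it suffices to compare monomials. Truncated subtraction of exponents
  could go wrong only for exponent 0, and there the coefficient is 0.\<close>

lemma pdiff_mult: "pdiff v (p * q) = p * pdiff v q + pdiff v p * q"
proof (induction p rule: poly_mapping_single_induct)
  case (1 m c)
  show ?case
  proof (induction q rule: poly_mapping_single_induct)
    case (1 m' c')
    let ?e = "single v 1 :: cox_var \<Rightarrow>\<^sub>0 nat"
    have left: "single (m - ?e + m') (of_nat (lookup m v) * c * c') =
        single (m + m' - ?e) (of_nat (lookup m v) * c * c')"
    proof (cases "lookup m v = 0")
      case False
      have "m + m' - ?e = (m - ?e + m') + ?e - ?e"
        using lookup_positive_decompose[OF False] by (metis add.assoc add.commute)
      then show ?thesis by simp
    qed simp
    have right: "single (m + (m' - ?e)) (of_nat (lookup m' v) * c * c') =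
        single (m + m' - ?e) (of_nat (lookup m' v) * c * c')"
    proof (cases "lookup m' v = 0")
      case False
      have "m + m' - ?e = (m + (m' - ?e)) + ?e - ?e"
        using lookup_positive_decompose[OF False] by (metis add.assoc)
      then show ?thesis by simp
    qed simp
    show ?case
      using left right
      by (simp add: mult_single pdiff_single lookup_add algebra_simps flip: single_add)
  qed (simp add: pdiff_add algebra_simps)
qed (simp add: pdiff_add algebra_simps)

interpretation pdiff: derivation "pdiff v"
  by unfold_locales (rule pdiff_add, rule pdiff_mult)

lemma pdiff_PConst [simp]: "pdiff v (PConst c) = 0"
  by (simp add: PConst_def pdiff_single)

lemma pdiff_PVar [simp]: "pdiff v (PVar w) = of_bool (v = w)"
  by (simp add: PVar_def pdiff_single lookup_single when_def)

lemma polys_in_pdiff: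
  assumes "p \<in> polys_in V"
  shows "pdiff v p \<in> polys_in V"
proof -
  \<comment> \<open>The product rule also involves the undifferentiated factors, so their membership
    is carried through the induction.\<close>
  have "p \<in> polys_in V \<and> pdiff v p \<in> polys_in V"
    using assms by (rule polys_in_induct[where K = UNIV])
      (auto intro: polys_in_add polys_in_mult simp: pdiff_add pdiff_mult of_bool_def)
  then show ?thesis ..
qed

lemma pdiff_not_occurring:
  assumes "p \<in> polys_in V" "v \<notin> V"
  shows "pdiff v p = 0"
  using assms(1) by (rule polys_in_induct[where K = UNIV])
    (use assms(2) in \<open>auto simp: pdiff_add pdiff_mult\<close>)

text \<open>The identity passes to sums and products, and constants satisfy it when \<delta> kills
  them. It yields the chain rule for substitutions as well as the derivative of a value
  \<open>peval u p\<close> along a derivation of the complex numbers.\<close>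

lemma (in scalar_hom) derivation_chain_rule:
  assumes \<delta>: "derivation \<delta>" and V: "finite V" and p: "p \<in> polys_in V"
    and coeffs: "\<And>m. \<delta> (h (lookup p m)) = 0"
  shows "\<delta> (poly_hom h \<sigma> p) = (\<Sum>v\<in>V. poly_hom h \<sigma> (pdiff v p) * \<delta> (\<sigma> v))"
  using p
proof (rule polys_in_induct[where K = "{c. \<delta> (h c) = 0}"])
  show "1 \<in> {c. \<delta> (h c) = 0}"
    by (simp add: scalar_one derivation.one[OF \<delta>])
next
  fix w assume w: "w \<in> V"
  have "(\<Sum>v\<in>V. poly_hom h \<sigma> (pdiff v (PVar w)) * \<delta> (\<sigma> v)) = (\<Sum>v\<in>V. if v = w then \<delta> (\<sigma> v) else 0)"
    by (intro sum.cong) (simp_all add: poly_hom_zero poly_hom_one)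
  then show "\<delta> (poly_hom h \<sigma> (PVar w)) = (\<Sum>v\<in>V. poly_hom h \<sigma> (pdiff v (PVar w)) * \<delta> (\<sigma> v))"
    using w V by (simp add: poly_hom_PVar)
next
  fix p q
  assume IH: "\<delta> (poly_hom h \<sigma> p) = (\<Sum>v\<in>V. poly_hom h \<sigma> (pdiff v p) * \<delta> (\<sigma> v))"
    "\<delta> (poly_hom h \<sigma> q) = (\<Sum>v\<in>V. poly_hom h \<sigma> (pdiff v q) * \<delta> (\<sigma> v))"
  show "\<delta> (poly_hom h \<sigma> (p + q)) = (\<Sum>v\<in>V. poly_hom h \<sigma> (pdiff v (p + q)) * \<delta> (\<sigma> v))"
    by (simp add: pdiff_add poly_hom_add derivation.add[OF \<delta>] IH sum.distrib distrib_right)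
  show "\<delta> (poly_hom h \<sigma> (p * q)) = (\<Sum>v\<in>V. poly_hom h \<sigma> (pdiff v (p * q)) * \<delta> (\<sigma> v))"
    by (simp add: pdiff_mult poly_hom_mult poly_hom_add derivation.mult[OF \<delta>] IH sum.distrib
        sum_distrib_left sum_distrib_right algebra_simps)
qed (use coeffs derivation.zero[OF \<delta>] in \<open>auto simp: poly_hom_zero poly_hom_PConst\<close>)

lemma pdiff_psubst:
  assumes "finite V" "p \<in> polys_in V"
  shows "pdiff v (psubst \<sigma> p) = (\<Sum>w\<in>V. psubst \<sigma> (pdiff w p) * pdiff v (\<sigma> w))"
  unfolding psubst_def
  by (rule subst_hom.derivation_chain_rule[OF pdiff.derivation_axioms assms]) simp

lemma derivation_peval:
  assumes "derivation \<delta>" "finite V" "p \<in> polys_in V" "\<And>m. \<delta> (lookup p m) = 0"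
  shows "\<delta> (peval u p) = (\<Sum>v\<in>V. peval u (pdiff v p) * \<delta> (u v))"
  unfolding peval_def
  by (rule eval_hom.derivation_chain_rule[OF assms(1-3)]) (simp add: assms(4))

lemma lookup_pdiff: "lookup (pdiff v p) m = of_nat (Suc (lookup m v)) * lookup p (m + single v 1)"
proof (induction p rule: poly_mapping_single_induct)
  case (1 k c)
  show ?case
  proof (cases "lookup k v = 0")
    case True
    then have "k \<noteq> m + single v 1" by (auto simp: lookup_add)
    with True show ?thesis by (simp add: pdiff_single lookup_single)
  next
    case False
    have "k - single v 1 = m \<longleftrightarrow> k = m + single v 1"
      using lookup_positive_decompose[OF False] by auto
    then show ?thesis by (auto simp: pdiff_single lookup_single when_def lookup_add)
  qed
qed (simp add: pdiff_add lookup_add algebra_simps)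

text \<open>On the fibre over the base point the chain rule is applied to first partial derivatives
  of \<open>F\<close>, so their coefficients must be constants too.\<close>

lemma derivation_lookup_pdiff:
  assumes "derivation \<delta>" "\<And>m. \<delta> (lookup p m) = 0"
  shows "\<delta> (lookup (pdiff v p) m) = 0"
  unfolding lookup_pdiff derivation.mult[OF assms(1)] assms(2) derivation.of_nat[OF assms(1)] by simp

section \<open>Weights and homogeneous polynomials\<close>

definition weight :: "(cox_var \<Rightarrow> int) \<Rightarrow> (cox_var \<Rightarrow>\<^sub>0 nat) \<Rightarrow> int" where
  "weight w m = (\<Sum>v\<in>keys m. int (lookup m v) * w v)"

lemma homogeneous_iff: "homogeneous w d p \<longleftrightarrow> (\<forall>m. lookup p m \<noteq> 0 \<longrightarrow> weight w m = d)"
  by (auto simp: homogeneous_def weight_def in_keys_iff)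

lemma weight_add: "weight w (m + m') = weight w m + weight w m'"
  unfolding weight_def
  by (rule setsum_keys_plus_distrib) (simp_all add: distrib_right)

lemma weight_single [simp]: "weight w (single v n) = int n * w v"
  by (simp add: weight_def)

lemma homogeneous_zero [simp]: "homogeneous w d 0"
  by (simp add: homogeneous_def)

lemma homogeneous_PConst [simp]: "homogeneous w 0 (PConst c)"
  by (simp add: homogeneous_def PConst_def)

lemma homogeneous_PVar [simp]: "homogeneous w d (PVar v) \<longleftrightarrow> d = w v"
  by (auto simp: homogeneous_def PVar_def)

lemma homogeneous_add: "homogeneous w d p \<Longrightarrow> homogeneous w d q \<Longrightarrow> homogeneous w d (p + q)"
  unfolding homogeneous_iff lookup_add by (metis add.right_neutral add_0)

lemma homogeneous_minus: "homogeneous w d p \<Longrightarrow> homogeneous w d (- p)"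
  by (simp add: homogeneous_iff)

lemma homogeneous_sum:
  "(\<And>i. i \<in> I \<Longrightarrow> homogeneous w d (f i)) \<Longrightarrow> homogeneous w d (\<Sum>i\<in>I. f i)"
  by (induction I rule: infinite_finite_induct) (auto intro: homogeneous_add)

lemma homogeneous_mult:
  assumes "homogeneous w d p" "homogeneous w e q"
  shows "homogeneous w (d + e) (p * q)"
  unfolding homogeneous_def
proof
  fix m assume "m \<in> keys (p * q)"
  then obtain a b where "m = a + b" "a \<in> keys p" "b \<in> keys q"
    using Poly_Mapping.keys_mult[of p q] by blast
  then show "(\<Sum>v\<in>keys m. int (lookup m v) * w v) = d + e"
    using assms weight_add[of w a b] by (auto simp: homogeneous_def weight_def)
qed

lemma homogeneous_power: "homogeneous w d p \<Longrightarrow> homogeneous w (int n * d) (p ^ n)"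
proof (induction n)
  case 0
  show ?case using homogeneous_PConst[of w 1] by simp
next
  case (Suc n)
  then show ?case using homogeneous_mult[of w d p "int n * d" "p ^ n"] by (simp add: algebra_simps)
qed

lemma homogeneous_psubst:
  assumes p: "homogeneous w d p" "p \<in> polys_in V"
    and \<sigma>: "\<And>v. v \<in> V \<Longrightarrow> homogeneous w' (w v) (\<sigma> v)"
  shows "homogeneous w' d (psubst \<sigma> p)"
  unfolding psubst_def poly_hom_def
proof (rule homogeneous_sum)
  fix m assume m: "m \<in> keys p"
  have "homogeneous w' (\<Sum>v\<in>W. int (lookup m v) * w v) (\<Prod>v\<in>W. \<sigma> v ^ lookup m v)" if "W \<subseteq> keys m" for W
    using that
  proof (induction W rule: infinite_finite_induct)
    case (insert v W)
    then have "v \<in> V" using p(2) m by (auto simp: polys_in_def)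
    with insert show ?case by (simp add: homogeneous_mult homogeneous_power \<sigma>)
  qed (use homogeneous_PConst[of w' 1] in auto)
  from homogeneous_mult[OF homogeneous_PConst[of w' "lookup p m"] this[OF subset_refl]]
  show "homogeneous w' d (PConst (lookup p m) * (\<Prod>v\<in>keys m. \<sigma> v ^ lookup m v))"
    using p(1) m by (simp add: homogeneous_def)
qed

lemma homogeneous_cong:
  assumes "p \<in> polys_in V" "\<And>v. v \<in> V \<Longrightarrow> w v = w' v"
  shows "homogeneous w d p \<longleftrightarrow> homogeneous w' d p"
proof -
  have "(\<Sum>v\<in>keys m. int (lookup m v) * w v) = (\<Sum>v\<in>keys m. int (lookup m v) * w' v)" if "m \<in> keys p" for m
    using assms that by (intro sum.cong) (auto simp: polys_in_def)
  then show ?thesis by (simp add: homogeneous_def)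
qed

lemma homogeneous_pdiff:
  assumes "homogeneous w d p"
  shows "homogeneous w (d - w v) (pdiff v p)"
  unfolding homogeneous_iff
proof (intro allI impI)
  fix m assume "lookup (pdiff v p) m \<noteq> 0"
  then have "lookup p (m + single v 1) \<noteq> 0" by (auto simp: lookup_pdiff)
  then have "weight w (m + single v 1) = d" using assms by (simp add: homogeneous_iff)
  then show "weight w m = d - w v" by (simp add: weight_add)
qed

text \<open>Each monomial is multiplied by the same power of \<open>s\<close>. Integer powers are
  used because the weight of \<open>VarZ\<close> may be negative.\<close>

lemma peval_scaled:
  assumes p: "homogeneous w d p" and s: "s \<noteq> 0"
  shows "peval (\<lambda>v. s powi w v * u v) p = s powi d * peval u p"
  unfolding peval_def poly_hom_def sum_distrib_left
proof (rule sum.cong[OF refl])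
  fix m assume "m \<in> keys p"
  then have d: "d = (\<Sum>v\<in>keys m. int (lookup m v) * w v)" using p by (simp add: homogeneous_def)
  have "(s powi w v) ^ n = s powi (int n * w v)" for v n
    by (metis power_int_mult power_int_of_nat mult.commute)
  moreover have "s powi (\<Sum>v\<in>W. f v) = (\<Prod>v\<in>W. s powi f v)" for W :: "cox_var set" and f
    using s by (induction W rule: infinite_finite_induct) (simp_all add: power_int_add)
  ultimately show "id (lookup p m) * (\<Prod>v\<in>keys m. (s powi w v * u v) ^ lookup m v) =
      s powi d * (id (lookup p m) * (\<Prod>v\<in>keys m. u v ^ lookup m v))"
    by (simp add: d power_mult_distrib prod.distrib)
qed

text \<open>Multiplying the derivative in \<open>v\<close> of a monomial by \<open>v\<close>
  multiplies the monomial by its exponent of \<open>v\<close>; the weighted sum of the exponents is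
  the degree.\<close>

lemma euler_identity:
  assumes "homogeneous w d p" "p \<in> polys_in V" "finite V"
  shows "(\<Sum>v\<in>V. of_int (w v) * (PVar v * pdiff v p)) = of_int d * p"
proof -
  have single: "PVar v * pdiff v (single m c) = of_nat (lookup m v) * single m c" for v m c
  proof (cases "lookup m v = 0")
    case False
    then show ?thesis
      using lookup_positive_decompose[OF False]
      by (simp add: PVar_def pdiff_single mult_single add.commute flip: single_of_nat)
  qed (simp add: pdiff_single)
  have monomial: "(\<Sum>v\<in>V. of_int (w v) * (PVar v * pdiff v (single m (lookup p m)))) = of_int d * single m (lookup p m)"
    if m: "m \<in> keys p" for m
  proof -
    have "weight w m = (\<Sum>v\<in>V. int (lookup m v) * w v)"
      unfolding weight_def using assms(2,3) m
      by (intro sum.mono_neutral_left) (auto simp: polys_in_def in_keys_iff)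
    then have d: "d = (\<Sum>v\<in>V. int (lookup m v) * w v)" 
      using assms(1) m by (simp add: homogeneous_def weight_def)
    show ?thesis
      by (simp add: d single sum_distrib_right mult.assoc mult.left_commute)
  qed
  have "(\<Sum>v\<in>V. of_int (w v) * (PVar v * pdiff v (\<Sum>m\<in>keys p. single m (lookup p m)))) =
      of_int d * (\<Sum>m\<in>keys p. single m (lookup p m))"
    unfolding pdiff.sum sum_distrib_left using monomial by (subst sum.swap) simp
  then show ?thesis by (simp only: poly_mapping_sum_singles)
qed

section \<open>Generic hyperplane sections\<close>

abbreviation cox_vars :: "nat \<Rightarrow> cox_var set" where
  "cox_vars j \<equiv> xvars j \<union> {VarY, VarZ}"

lemma VarX_in_xvars [simp]: "VarX i \<in> xvars j \<longleftrightarrow> i \<le> j"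
  and VarYZ_notin_xvars [simp]: "VarY \<notin> xvars j" "VarZ \<notin> xvars j"
  and finite_xvars [simp]: "finite (xvars j)"
  by (auto simp: xvars_def)

lemma cox_vars_pred:
  assumes "j \<ge> 1"
  shows "cox_vars j = insert (VarX j) (cox_vars (j - 1))" "VarX j \<notin> cox_vars (j - 1)"
  using assms by (auto simp: xvars_def)

section \<open>Singular points under scaling and substitution\<close>

definition singular_at :: "cox_var set \<Rightarrow> cpoly \<Rightarrow> (cox_var \<Rightarrow> complex) \<Rightarrow> bool" where
  "singular_at V f u \<longleftrightarrow> peval u f = 0 \<and> (\<forall>v\<in>V. peval u (pdiff v f) = 0)"

lemma smooth_hypersurface_on_iff:
  "smooth_hypersurface_on V U f \<longleftrightarrow> (\<forall>u\<in>U. \<not> singular_at V f u)"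
  by (auto simp: smooth_hypersurface_on_def singular_at_def)

text \<open>Partial derivatives of a homogeneous polynomial are homogeneous, so the torus action
  permutes the singular points.\<close>

lemma singular_at_scaled:
  assumes "homogeneous w d f" "s \<noteq> 0" "singular_at V f u"
  shows "singular_at V f (\<lambda>v. s powi w v * u v)"
  using assms unfolding singular_at_def
  by (simp add: peval_scaled[OF assms(1,2)] peval_scaled[OF homogeneous_pdiff[OF assms(1)] assms(2)])

lemma peval_psubst_update:
  "peval u (psubst (PVar(x := g)) f) = peval (u(x := peval u g)) f"
proof -
  have "(\<lambda>v. peval u ((PVar(x := g)) v)) = u(x := peval u g)" by auto
  then show ?thesis by (simp add: peval_psubst)
qed

text \<open>Here \<open>g\<close> may contain \<open>x\<close>, so the formula covers the shear as
  well as sections and dehomogenization.\<close>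

lemma peval_pdiff_psubst_update:
  assumes "finite V" "f \<in> polys_in V" "x \<in> V"
  shows "peval u (pdiff v (psubst (PVar(x := g)) f)) =
    (if v = x then 0 else peval (u(x := peval u g)) (pdiff v f)) +
    peval (u(x := peval u g)) (pdiff x f) * peval u (pdiff v g)"
proof -
  let ?u = "u(x := peval u g)"
  have "peval u (pdiff v (psubst (PVar(x := g)) f)) =
      (\<Sum>w\<in>V. peval ?u (pdiff w f) * peval u (pdiff v ((PVar(x := g)) w)))"
    by (simp only: pdiff_psubst[OF assms(1,2)] peval_simps peval_psubst_update)
  also have "\<dots> = peval ?u (pdiff x f) * peval u (pdiff v g) +
      (\<Sum>w\<in>V - {x}. peval ?u (pdiff w f) * peval u (pdiff v ((PVar(x := g)) w)))"
    using assms by (subst sum.remove[of _ x]) auto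
  also have "(\<Sum>w\<in>V - {x}. peval ?u (pdiff w f) * peval u (pdiff v ((PVar(x := g)) w))) =
      (\<Sum>w\<in>V - {x}. if w = v then peval ?u (pdiff v f) else 0)"
    by (intro sum.cong) auto
  also have "\<dots> = (if v = x then 0 else peval ?u (pdiff v f))"
    using assms pdiff_not_occurring[OF assms(2), of v] by auto
  finally show ?thesis by (simp only: add.commute)
qed

text \<open>The scalars \<open>c i\<close> need not be constants of \<delta>. The resulting extra
  sum is what lets a derivation single out the value of one \<open>g i\<close>.\<close>

lemma derivation_peval_combination:
  assumes \<delta>: "derivation \<delta>" and V: "finite V"
    and g: "\<And>i. i \<in> I \<Longrightarrow> g i \<in> polys_in V" "\<And>i m. \<delta> (lookup (g i) m) = 0"
  shows "\<delta> (peval u (\<Sum>i\<in>I. PConst (c i) * g i)) = (\<Sum>i\<in>I. \<delta> (c i) * peval u (g i)) +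
    (\<Sum>v\<in>V. peval u (pdiff v (\<Sum>i\<in>I. PConst (c i) * g i)) * \<delta> (u v))"
proof -
  have "\<delta> (peval u (\<Sum>i\<in>I. PConst (c i) * g i)) =
      (\<Sum>i\<in>I. c i * (\<Sum>v\<in>V. peval u (pdiff v (g i)) * \<delta> (u v)) + \<delta> (c i) * peval u (g i))"
    using g by (simp add: derivation.sum[OF \<delta>] derivation.mult[OF \<delta>] derivation_peval[OF \<delta> V])
  also have "\<dots> = (\<Sum>i\<in>I. \<delta> (c i) * peval u (g i)) +
      (\<Sum>i\<in>I. \<Sum>v\<in>V. c i * peval u (pdiff v (g i)) * \<delta> (u v))"
    by (simp add: sum.distrib sum_distrib_left mult.assoc add.commute)
  also have "(\<Sum>i\<in>I. \<Sum>v\<in>V. c i * peval u (pdiff v (g i)) * \<delta> (u v)) =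
      (\<Sum>v\<in>V. peval u (pdiff v (\<Sum>i\<in>I. PConst (c i) * g i)) * \<delta> (u v))"
    by (subst sum.swap) (simp add: pdiff.sum pdiff_mult sum_distrib_right)
  finally show ?thesis .
qed

section \<open>The linear system of sections\<close>

definition bihomogeneous :: "(nat \<Rightarrow> nat) \<Rightarrow> nat \<Rightarrow> int \<times> int \<Rightarrow> cpoly \<Rightarrow> bool" where
  "bihomogeneous a e d F \<longleftrightarrow> homogeneous (\<lambda>v. fst (cox_deg a e v)) (fst d) F \<and>
     homogeneous (\<lambda>v. snd (cox_deg a e v)) (snd d) F"

text \<open>
  The linear system spanned by the following sections cuts out the fibre over the base point, and
  its members have arbitrary tangent directions there.
\<close>

definition system_section :: "nat \<Rightarrow> nat \<Rightarrow> (nat \<Rightarrow> complex) \<Rightarrow> (nat \<Rightarrow> complex) \<Rightarrow> cpoly" where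
  "system_section j d s t = (\<Sum>i=1..<j. PConst (s i) * PVar (VarX i) ^ d) +
     (\<Sum>i=1..<j. PConst (t i) * (PVar (VarX 0) ^ (d - 1) * PVar (VarX i)))"

lemma system_section_in: "system_section j d s t \<in> polys_in (xvars (j - 1))"
  unfolding system_section_def
  by (intro polys_in_add polys_in_sum polys_in_mult polys_in_power) auto

text \<open>No term is a power of \<open>VarX 0\<close> alone. Hence the shears fix the base point
  and the origin.\<close>

lemma peval_system_section_zero:
  assumes "d \<ge> 1" "\<And>i. 1 \<le> i \<Longrightarrow> i < j \<Longrightarrow> u (VarX i) = 0"
  shows "peval u (system_section j d s t) = 0"
  using assms by (auto simp: system_section_def zero_power intro!: sum.neutral)

text \<open>The common weight \<open>e\<close> is 1 for the first grading of the Cox ring and 0 for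
  the second, so both degrees of a section come from here.\<close>

lemma homogeneous_system_section:
  assumes "d \<ge> 1" "\<And>i. i < j \<Longrightarrow> w (VarX i) = e"
  shows "homogeneous w (int d * e) (system_section j d s t)"
proof -
  have X: "homogeneous w e (PVar (VarX i))" if "i < j" for i
    using that assms(2) by simp
  have s: "homogeneous w (int d * e) (PConst (s i) * PVar (VarX i) ^ d)" if "i < j" for i
    using homogeneous_mult[OF homogeneous_PConst homogeneous_power[OF X[OF that]]] by simp
  have deg: "0 + (int (d - 1) * e + e) = int d * e"
    using assms(1) by (simp add: algebra_simps of_nat_diff)
  have t: "homogeneous w (int d * e) (PConst (t i) * (PVar (VarX 0) ^ (d - 1) * PVar (VarX i)))"
    if "i < j" for i
    unfolding deg[symmetric]
    by (intro homogeneous_mult homogeneous_PConst homogeneous_power X) (use that in auto)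
  show ?thesis
    unfolding system_section_def by (intro homogeneous_add homogeneous_sum s t) auto
qed

lemma derivation_system_section:
  assumes \<delta>: "derivation \<delta>" and "finite V" "xvars (j - 1) \<subseteq> V"
  shows "\<delta> (peval u (system_section j d s t)) =
    (\<Sum>i=1..<j. \<delta> (s i) * u (VarX i) ^ d) +
    (\<Sum>i=1..<j. \<delta> (t i) * (u (VarX 0) ^ (d - 1) * u (VarX i))) +
    (\<Sum>v\<in>V. peval u (pdiff v (system_section j d s t)) * \<delta> (u v))"
proof -
  define g1 where "g1 = (\<lambda>i. PVar (VarX i) ^ d)"
  define g2 where "g2 = (\<lambda>i. PVar (VarX 0) ^ (d - 1) * PVar (VarX i))"
  have PVar_pow: "PVar v ^ n = single (single v n) 1" for v n
    by (induction n) (simp_all add: PVar_def mult_single flip: single_add)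
  have PVar_mult: "PVar x ^ n * PVar v = single (single x n + single v 1) 1" for x v n
    unfolding PVar_pow by (simp add: PVar_def mult_single)
  have one: "\<delta> (1 when b) = 0" for b
    using derivation.one[OF \<delta>] derivation.zero[OF \<delta>] by (simp add: when_def)
  have in1: "g1 i \<in> polys_in V" "g2 i \<in> polys_in V" if "i \<in> {1..<j}" for i
    using that assms(3) unfolding g1_def g2_def
    by (auto intro!: polys_in_mult polys_in_power subsetD[OF assms(3)])
  \<comment> \<open>Both kinds of monomials have only coefficients 0 and 1, which every derivation
    kills.\<close>
  have coeffs: "\<delta> (lookup (g1 i) m) = 0" "\<delta> (lookup (g2 i) m) = 0" for i m
    unfolding g1_def g2_def PVar_mult unfolding PVar_pow by (simp_all add: lookup_single one)
  have eq: "system_section j d s t =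
      (\<Sum>i=1..<j. PConst (s i) * g1 i) + (\<Sum>i=1..<j. PConst (t i) * g2 i)"
    by (simp add: system_section_def g1_def g2_def)
  have "peval u (system_section j d s t) =
      peval u (\<Sum>i=1..<j. PConst (s i) * g1 i) + peval u (\<Sum>i=1..<j. PConst (t i) * g2 i)"
    unfolding eq by (simp only: peval_simps)
  then have "\<delta> (peval u (system_section j d s t)) =
      (\<Sum>i=1..<j. \<delta> (s i) * peval u (g1 i)) + (\<Sum>i=1..<j. \<delta> (t i) * peval u (g2 i)) +
      (\<Sum>v\<in>V. peval u (pdiff v (system_section j d s t)) * \<delta> (u v))"
    unfolding eq pdiff_add
    by (simp only: derivation.add[OF \<delta>] peval_simps(5) distrib_right sum.distrib
        derivation_peval_combination[OF \<delta> assms(2) in1(1) coeffs(1)]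
        derivation_peval_combination[OF \<delta> assms(2) in1(2) coeffs(2)])
      (simp only: ac_simps)
  then show ?thesis
    by (simp add: g1_def g2_def)
qed

text \<open>The pure powers contribute at the base point only for \<open>d = 1\<close>, where
  \<open>0 ^ 0 = 1\<close>. The formula keeps this term, because \<open>d = 1\<close> is the case of
  all \<open>j < n\<close>.\<close>

lemma pdiff_system_section_base:
  assumes i: "1 \<le> i" "i < j" and u: "u (VarX 0) = 1" "\<And>i. 1 \<le> i \<Longrightarrow> i < j \<Longrightarrow> u (VarX i) = 0"
  shows "peval u (pdiff (VarX i) (system_section j d s t)) = s i * (of_nat d * 0 ^ (d - 1)) + t i"
proof -
  have of_nat: "peval u (of_nat n) = of_nat n" for n
    by (induction n) auto
  have "peval u (pdiff (VarX i) (system_section j d s t)) =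
      (\<Sum>l=1..<j. if l = i then s l * (of_nat d * 0 ^ (d - 1)) else 0) + (\<Sum>l=1..<j. if l = i then t l else 0)"
    unfolding system_section_def pdiff_add pdiff.sum peval_simps
    by (intro arg_cong2[of _ _ _ _ "(+)"] sum.cong refl)
      (use u i in \<open>auto simp: pdiff_mult pdiff.power of_nat of_bool_def\<close>)
  then show ?thesis using i by simp
qed

section \<open>Tangency of a section to the hypersurface\<close>

text \<open>The point \<open>u'\<close> lies over \<open>u\<close> on the graph of \<open>h\<close>.
  By the chain rule a singularity of the section means that dF at \<open>u'\<close> is a multiple of
  d(x_j - h), the factor being the derivative of \<open>F\<close> in x_j.\<close>

lemma singular_section:
  assumes j: "j \<ge> 1" and F: "F \<in> cox_ring j" and h: "h \<in> polys_in (xvars (j - 1))"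
    and sing: "singular_at (cox_vars (j - 1)) (psubst (PVar(VarX j := h)) F) u"
  defines "u' \<equiv> u(VarX j := peval u h)"
  shows "peval u' F = 0"
    and "\<And>v. v \<in> cox_vars (j - 1) \<Longrightarrow>
      peval u' (pdiff v F) + peval u' (pdiff (VarX j) F) * peval u (pdiff v h) = 0"
proof -
  show "peval u' F = 0"
    using sing by (simp add: singular_at_def peval_psubst_update u'_def)
  fix v assume v: "v \<in> cox_vars (j - 1)"
  then have "v \<noteq> VarX j" using cox_vars_pred(2)[OF j] by blast
  then have "peval u (pdiff v (psubst (PVar(VarX j := h)) F)) =
      peval u' (pdiff v F) + peval u' (pdiff (VarX j) F) * peval u (pdiff v h)"
    using peval_pdiff_psubst_update[of "cox_vars j" F "VarX j" u v h] F
    by (simp add: cox_ring_def u'_def)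
  moreover have "peval u (pdiff v (psubst (PVar(VarX j := h)) F)) = 0"
    using sing v unfolding singular_at_def by blast
  ultimately show "peval u' (pdiff v F) + peval u' (pdiff (VarX j) F) * peval u (pdiff v h) = 0"
    by simp
qed

text \<open>
  Differentiating the equation \<open>F(u') = 0\<close> and using that \<open>dF\<close> is proportional to the conormal
  \<open>d(x\<^sub>j - h)\<close> of the section leaves only the derivatives of the coefficients of \<open>h\<close>.
\<close>

lemma singular_section_derivation:
  assumes \<delta>: "derivation \<delta>" and coeffs: "\<And>m. \<delta> (lookup F m) = 0"
    and j: "j \<ge> 1" and F: "F \<in> cox_ring j" and h: "h \<in> polys_in (xvars (j - 1))"
    and sing: "singular_at (cox_vars (j - 1)) (psubst (PVar(VarX j := h)) F) u"
    and nz: "peval (u(VarX j := peval u h)) (pdiff (VarX j) F) \<noteq> 0"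
  shows "\<delta> (peval u h) = (\<Sum>v\<in>cox_vars (j - 1). peval u (pdiff v h) * \<delta> (u v))"
proof -
  define u' where "u' = u(VarX j := peval u h)"
  define \<mu> where "\<mu> = peval u' (pdiff (VarX j) F)"
  note sec = singular_section[OF j F h sing, folded u'_def]
  have u'v: "u' v = u v" if "v \<in> cox_vars (j - 1)" for v
    using that cox_vars_pred(2)[OF j] by (auto simp: u'_def)
  have "0 = \<delta> (peval u' F)"
    using sec(1) derivation.zero[OF \<delta>] by simp
  also have "\<dots> = (\<Sum>v\<in>cox_vars j. peval u' (pdiff v F) * \<delta> (u' v))"
    using F by (intro derivation_peval[OF \<delta>] coeffs) (auto simp: cox_ring_def)
  also have "\<dots> = \<mu> * \<delta> (peval u h) + (\<Sum>v\<in>cox_vars (j - 1). peval u' (pdiff v F) * \<delta> (u' v))"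
    unfolding cox_vars_pred(1)[OF j]
    using cox_vars_pred(2)[OF j] by (subst sum.insert) (auto simp: \<mu>_def u'_def)
  also have "(\<Sum>v\<in>cox_vars (j - 1). peval u' (pdiff v F) * \<delta> (u' v)) =
      (\<Sum>v\<in>cox_vars (j - 1). - \<mu> * (peval u (pdiff v h) * \<delta> (u v)))"
  proof (rule sum.cong[OF refl])
    fix v assume v: "v \<in> cox_vars (j - 1)"
    have "peval u' (pdiff v F) = - \<mu> * peval u (pdiff v h)"
      using sec(2)[OF v] by (simp add: \<mu>_def eq_neg_iff_add_eq_0)
    then show "peval u' (pdiff v F) * \<delta> (u' v) = - \<mu> * (peval u (pdiff v h) * \<delta> (u v))"
      using u'v[OF v] by simp
  qed
  also have "\<dots> = - \<mu> * (\<Sum>v\<in>cox_vars (j - 1). peval u (pdiff v h) * \<delta> (u v))"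
    by (rule sum_distrib_left[symmetric])
  finally have "\<mu> * (\<delta> (peval u h) - (\<Sum>v\<in>cox_vars (j - 1). peval u (pdiff v h) * \<delta> (u v))) = 0"
    by (simp add: algebra_simps)
  then show ?thesis using nz by (simp add: \<mu>_def u'_def)
qed

lemma bihomogeneous_section:
  assumes "\<And>i. i < j \<Longrightarrow> a i = 1" "1 \<le> a j" "j \<ge> 1" "F \<in> cox_ring j" "bihomogeneous a e d F"
  shows "bihomogeneous a e d (psubst (PVar(VarX j := system_section j (a j) s t)) F)"
  unfolding bihomogeneous_def
proof
  have "homogeneous (\<lambda>v. fst (cox_deg a e v)) (int (a j) * 1) (system_section j (a j) s t)"
    by (rule homogeneous_system_section) (use assms in auto)
  then show "homogeneous (\<lambda>v. fst (cox_deg a e v)) (fst d) (psubst (PVar(VarX j := system_section j (a j) s t)) F)"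
    using assms(4,5) unfolding bihomogeneous_def cox_ring_def by (elim conjE homogeneous_psubst) auto
  have "homogeneous (\<lambda>v. snd (cox_deg a e v)) (int (a j) * 0) (system_section j (a j) s t)"
    by (rule homogeneous_system_section) (use assms in auto)
  then show "homogeneous (\<lambda>v. snd (cox_deg a e v)) (snd d) (psubst (PVar(VarX j := system_section j (a j) s t)) F)"
    using assms(4,5) unfolding bihomogeneous_def cox_ring_def by (elim conjE homogeneous_psubst) auto
qed

lemma section_point_in_domain:
  assumes "u \<in> cox_domain (j - 1)" "j \<ge> 1"
  shows "u(VarX j := z) \<in> cox_domain j"
proof -
  from assms obtain i where "i \<le> j - 1" "u (VarX i) \<noteq> 0" by (auto simp: cox_domain_def)
  then have "i \<le> j" "(u(VarX j := z)) (VarX i) \<noteq> 0" using assms(2) by auto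
  then show ?thesis using assms(1) unfolding cox_domain_def by fastforce
qed

text \<open>Over the base point the two-dimensional torus normalizes x_0 and a nonzero one of y, z
  to 1. Only the fibre coordinate \<open>b\<close> remains free, and derivations kill all the
  others.\<close>

lemma normalize_point:
  assumes a0: "a 0 = 1" and f: "bihomogeneous a e d f" and u: "u \<in> cox_domain m"
    and x: "\<And>i. 1 \<le> i \<Longrightarrow> i \<le> m \<Longrightarrow> u (VarX i) = 0" and sing: "singular_at V f u"
  obtains w b where "singular_at V f w" "w (VarX 0) = 1" "\<And>i. 1 \<le> i \<Longrightarrow> i \<le> m \<Longrightarrow> w (VarX i) = 0"
    "b \<in> {VarY, VarZ}" "\<And>v. v \<in> {VarY, VarZ} \<Longrightarrow> v \<noteq> b \<Longrightarrow> w v = 1"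
proof -
  have u0: "u (VarX 0) \<noteq> 0"
  proof
    assume "u (VarX 0) = 0"
    then have "u (VarX i) = 0" if "i \<le> m" for i
      using x[of i] that by (cases "i = 0") auto
    then show False using u by (auto simp: cox_domain_def)
  qed
  define u1 where "u1 = (\<lambda>v. inverse (u (VarX 0)) powi fst (cox_deg a e v) * u v)"
  have sing1: "singular_at V f u1"
    unfolding u1_def using f u0 sing by (intro singular_at_scaled) (auto simp: bihomogeneous_def)
  have u1: "u1 (VarX 0) = 1" "\<And>i. 1 \<le> i \<Longrightarrow> i \<le> m \<Longrightarrow> u1 (VarX i) = 0" "u1 VarY \<noteq> 0 \<or> u1 VarZ \<noteq> 0"
    using u0 a0 x u by (auto simp: u1_def cox_domain_def)
  obtain c b where cb: "{c, b} = {VarY, VarZ}" "c \<noteq> b" "u1 c \<noteq> 0"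
  proof (cases "u1 VarY = 0")
    case True
    then show ?thesis using u1(3) by (intro that[of VarZ VarY]) auto
  next
    case False
    then show ?thesis by (intro that[of VarY VarZ]) auto
  qed
  \<comment> \<open>The second grading gives every \<open>VarX i\<close> weight 0, so this scaling
    preserves the normalization of x_0.\<close>
  define w where "w = (\<lambda>v. inverse (u1 c) powi snd (cox_deg a e v) * u1 v)"
  have "snd (cox_deg a e c) = 1" using cb(1) by (auto simp: doubleton_eq_iff)
  then have "w c = 1" using cb(3) by (simp add: w_def)
  moreover have "singular_at V f w"
    unfolding w_def using f cb(3) sing1 by (intro singular_at_scaled) (auto simp: bihomogeneous_def)
  moreover have "w (VarX i) = u1 (VarX i)" for i by (simp add: w_def)
  ultimately show ?thesis
    using u1(1,2) cb(1,2) by (intro that[of w b]) (auto simp: doubleton_eq_iff)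
qed

section \<open>Smoothness of the generic section\<close>

text \<open>If the derivative in x_j vanished as well, tangency would make the quasi-smooth
  \<open>F\<close> singular at the point over \<open>u\<close>. The derivation dual to
  \<open>s l\<close> then isolates the monomial x_l^d.\<close>

lemma generic_section_off_base:
  assumes j: "j \<ge> 1" and F: "F \<in> cox_ring j" "quasismooth j F"
    and u: "u \<in> cox_domain (j - 1)"
    and sing: "singular_at (cox_vars (j - 1)) (psubst (PVar(VarX j := system_section j d s t)) F) u"
    and \<delta>: "\<And>l. 1 \<le> l \<Longrightarrow> l < j \<Longrightarrow> derivation (\<delta> l)" "\<And>l m. 1 \<le> l \<Longrightarrow> l < j \<Longrightarrow> \<delta> l (lookup F m) = 0"
    and \<delta>s: "\<And>l i. 1 \<le> l \<Longrightarrow> l < j \<Longrightarrow> 1 \<le> i \<Longrightarrow> i < j \<Longrightarrow> \<delta> l (s i) = of_bool (l = i)"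
    and \<delta>t: "\<And>l i. 1 \<le> l \<Longrightarrow> l < j \<Longrightarrow> 1 \<le> i \<Longrightarrow> i < j \<Longrightarrow> \<delta> l (t i) = 0"
  shows "peval (u(VarX j := peval u (system_section j d s t))) (pdiff (VarX j) F) \<noteq> 0"
    and "\<And>l. 1 \<le> l \<Longrightarrow> l < j \<Longrightarrow> u (VarX l) = 0"
proof -
  let ?h = "system_section j d s t"
  let ?u = "u(VarX j := peval u ?h)"
  note sec = singular_section[OF j F(1) system_section_in sing]
  show nz: "peval ?u (pdiff (VarX j) F) \<noteq> 0"
  proof
    assume 0: "peval ?u (pdiff (VarX j) F) = 0"
    have "singular_at (cox_vars j) F ?u"
      unfolding singular_at_def cox_vars_pred(1)[OF j] using sec 0 by auto
    moreover have "?u \<in> cox_domain j" by (rule section_point_in_domain[OF u j])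
    ultimately show False
      using F(2) by (auto simp: quasismooth_def smooth_hypersurface_on_iff)
  qed
  fix l assume l: "1 \<le> l" "l < j"
  have "\<delta> l (peval u ?h) = (\<Sum>v\<in>cox_vars (j - 1). peval u (pdiff v ?h) * \<delta> l (u v))"
    using singular_section_derivation[OF \<delta>(1)[OF l] \<delta>(2)[OF l] j F(1) system_section_in sing nz] .
  moreover have "\<delta> l (peval u ?h) = (\<Sum>i=1..<j. \<delta> l (s i) * u (VarX i) ^ d) +
      (\<Sum>i=1..<j. \<delta> l (t i) * (u (VarX 0) ^ (d - 1) * u (VarX i))) +
      (\<Sum>v\<in>cox_vars (j - 1). peval u (pdiff v ?h) * \<delta> l (u v))"
    by (rule derivation_system_section[OF \<delta>(1)[OF l]]) auto
  moreover have "(\<Sum>i=1..<j. \<delta> l (s i) * u (VarX i) ^ d) = (\<Sum>i=1..<j. if i = l then u (VarX l) ^ d else 0)"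
    by (intro sum.cong) (use \<delta>s l in auto)
  moreover have "(\<Sum>i=1..<j. if i = l then u (VarX l) ^ d else 0) = u (VarX l) ^ d"
    using l by simp
  moreover have "(\<Sum>i=1..<j. \<delta> l (t i) * (u (VarX 0) ^ (d - 1) * u (VarX i))) = 0"
    by (intro sum.neutral) (use \<delta>t l in auto)
  \<comment> \<open>Two expressions for the derivative of the value of the section are compared;
    their chain rule sums agree and cancel.\<close>
  ultimately have "u (VarX l) ^ d = 0"
    by (simp only: add_0_right add_cancel_left_left)
  then show "u (VarX l) = 0" by simp
qed

text \<open>
  On the fibre over the base point only one coordinate \<open>b\<close> varies, whereas tangency prescribes at
  least two independent parameters \<open>t\<^sub>1\<close>, \<open>t\<^sub>2\<close> as functions of it.
\<close>

lemma generic_section_on_base: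
  assumes j: "j \<ge> 3" and d: "d \<ge> 1" and F: "F \<in> cox_ring j"
    and sing: "singular_at (cox_vars (j - 1)) (psubst (PVar(VarX j := system_section j d s t)) F) u"
    and u: "u (VarX 0) = 1" "\<And>i. 1 \<le> i \<Longrightarrow> i < j \<Longrightarrow> u (VarX i) = 0"
    and b: "b \<in> {VarY, VarZ}" "\<And>v. v \<in> {VarY, VarZ} \<Longrightarrow> v \<noteq> b \<Longrightarrow> u v = 1"
    and \<delta>: "\<And>l. l \<in> {1, 2} \<Longrightarrow> derivation (\<delta> l)" "\<And>l m. l \<in> {1, 2} \<Longrightarrow> \<delta> l (lookup F m) = 0"
    and \<delta>s: "\<And>l i. l \<in> {1, 2} \<Longrightarrow> i \<in> {1, 2} \<Longrightarrow> \<delta> l (s i) = 0"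
    and \<delta>t: "\<And>l i. l \<in> {1, 2} \<Longrightarrow> i \<in> {1, 2} \<Longrightarrow> \<delta> l (t i) = of_bool (l = i)"
  shows "peval (u(VarX j := peval u (system_section j d s t))) (pdiff (VarX j) F) = 0"
proof (rule ccontr)
  let ?h = "system_section j d s t"
  define u' where "u' = u(VarX j := peval u ?h)"
  define \<mu> where "\<mu> = peval u' (pdiff (VarX j) F)"
  define q where "q = (\<lambda>i. peval u' (pdiff (VarX i) F))"
  define \<tau> where "\<tau> = (\<lambda>i. peval u (pdiff (VarX i) ?h))"
  \<comment> \<open>This is the coefficient of \<open>\<delta> l (u b)\<close> when the relation
    \<open>q i + \<mu> * \<tau> i = 0\<close> is differentiated.\<close>
  define A where "A = (\<lambda>i. peval u' (pdiff b (pdiff (VarX i) F)) + peval u' (pdiff b (pdiff (VarX j) F)) * \<tau> i)"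
  assume "peval (u(VarX j := peval u ?h)) (pdiff (VarX j) F) \<noteq> 0"
  then have \<mu>: "\<mu> \<noteq> 0" by (simp add: \<mu>_def u'_def)
  \<comment> \<open>The bound \<open>j \<ge> 3\<close> makes \<open>VarX 1\<close> and
    \<open>VarX 2\<close> variables of the section, so two tangency relations are available.\<close>
  have j1: "j \<ge> 1" using j by simp
  have rel: "q i + \<mu> * \<tau> i = 0" if "i \<in> {1, 2}" for i
    using singular_section(2)[OF j1 F system_section_in sing, of "VarX i"] that j
    by (auto simp: q_def \<mu>_def \<tau>_def u'_def)
  have h0: "peval u ?h = 0" by (rule peval_system_section_zero) (use d u(2) in auto)
  \<comment> \<open>The coordinate x_j of \<open>u'\<close> is 0 because the section vanishes there.
    So every coordinate except \<open>b\<close> is a constant for all derivations.\<close>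
  have u'01: "u' v \<in> {0, 1}" if "v \<in> cox_vars j" "v \<noteq> b" for v
  proof (cases v)
    case (VarX i)
    then show ?thesis
      using that(1) u(1) u(2)[of i] h0 by (cases "i = 0"; cases "i = j") (auto simp: u'_def)
  qed (use that b(2) in \<open>auto simp: u'_def\<close>)
  have chain: "\<delta> l (peval u' G) = peval u' (pdiff b G) * \<delta> l (u b)"
    if l: "l \<in> {1, 2}" and G: "G \<in> polys_in (cox_vars j)" "\<And>m. \<delta> l (lookup G m) = 0" for l G
  proof -
    have "\<delta> l (peval u' G) = (\<Sum>v\<in>cox_vars j. peval u' (pdiff v G) * \<delta> l (u' v))"
      using \<delta>(1)[OF l] G by (intro derivation_peval) auto
    also have "\<dots> = (\<Sum>v\<in>cox_vars j. if v = b then peval u' (pdiff b G) * \<delta> l (u' b) else 0)"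
    proof (intro sum.cong refl)
      fix v assume v: "v \<in> cox_vars j"
      have "\<delta> l (u' v) = 0" if "v \<noteq> b"
        using u'01[OF v that] derivation.zero[OF \<delta>(1)[OF l]] derivation.one[OF \<delta>(1)[OF l]] by auto
      then show "peval u' (pdiff v G) * \<delta> l (u' v) = (if v = b then peval u' (pdiff b G) * \<delta> l (u' b) else 0)"
        by simp
    qed
    also have "\<dots> = peval u' (pdiff b G) * \<delta> l (u b)"
      using b(1) by (auto simp: u'_def)
    finally show ?thesis .
  qed
  have \<delta>\<tau>: "\<delta> l (\<tau> i) = of_bool (l = i)" if "l \<in> {1, 2}" "i \<in> {1, 2}" for l i
  proof -
    \<comment> \<open>Written as a natural number, this factor is visibly killed by
      derivations.\<close>
    have c: "of_nat d * 0 ^ (d - 1) = (of_nat (d * 0 ^ (d - 1)) :: complex)" by simp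
    have "\<tau> i = s i * of_nat (d * 0 ^ (d - 1)) + t i"
      unfolding \<tau>_def c[symmetric] by (rule pdiff_system_section_base) (use that j u in auto)
    then show ?thesis
      using \<delta>s[OF that] \<delta>t[OF that]
      by (simp only: derivation.add[OF \<delta>(1)[OF that(1)]] derivation.mult[OF \<delta>(1)[OF that(1)]]
          derivation.of_nat[OF \<delta>(1)[OF that(1)]]) simp
  qed
  have main: "A i * \<delta> l (u b) + \<mu> * of_bool (l = i) = 0" if l: "l \<in> {1, 2}" and i: "i \<in> {1, 2}" for l i
  proof -
    note \<delta>l = \<delta>(1)[OF l]
    have G: "pdiff v F \<in> polys_in (cox_vars j)" "\<delta> l (lookup (pdiff v F) m) = 0" for v m
      using F \<delta>(2)[OF l] by (auto simp: cox_ring_def intro: polys_in_pdiff derivation_lookup_pdiff[OF \<delta>l])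
    have "\<delta> l (q i + \<mu> * \<tau> i) = 0" using rel[OF i] derivation.zero[OF \<delta>l] by simp
    then show ?thesis
      unfolding derivation.add[OF \<delta>l] derivation.mult[OF \<delta>l] \<delta>\<tau>[OF l i] unfolding q_def \<mu>_def chain[OF l G]
      by (simp add: A_def algebra_simps)
  qed
  \<comment> \<open>Both derivations act on the single coordinate \<open>b\<close>: the diagonal
    relation gives \<open>A 1 \<noteq> 0\<close>, the mixed one then makes
    \<open>\<delta> 2 (u b)\<close> vanish, and the second diagonal one forces
    \<open>\<mu> = 0\<close>.\<close>
  have "A 1 \<noteq> 0" using main[of 1 1] \<mu> by auto
  then have "\<delta> 2 (u b) = 0" using main[of 2 1] by simp
  then show False using main[of 2 2] \<mu> by simp
qed

text \<open>One countable ring contains the coefficients of all equations in the finite set, so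
  parameters independent over it are generic for all of them at once.\<close>

lemma generic_section:
  assumes j: "j \<ge> 3" and a: "\<And>i. i < j \<Longrightarrow> a i = 1" "1 \<le> a j" and "finite \<F>"
    and \<F>: "\<And>F. F \<in> \<F> \<Longrightarrow> F \<in> cox_ring j \<and> (\<exists>d. bihomogeneous a e d F) \<and> quasismooth j F"
  obtains s t where "\<And>F. F \<in> \<F> \<Longrightarrow>
    quasismooth (j - 1) (psubst (PVar(VarX j := system_section j (a j) s t)) F)"
proof -
  have "finite (\<Union>F\<in>\<F>. lookup F ` keys F)"
    using assms(4) by simp
  then obtain S where S: "countable S" "subring S" "(\<Union>F\<in>\<F>. lookup F ` keys F) \<subseteq> S"
    using countable_subring_containing by blast
  obtain t :: "nat \<Rightarrow> complex" and D where D: "\<And>i. i < 2 * j \<Longrightarrow> derivation (D i)"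
    "\<And>i c. i < 2 * j \<Longrightarrow> c \<in> S \<Longrightarrow> D i c = 0"
    "\<And>i l. i < 2 * j \<Longrightarrow> l < 2 * j \<Longrightarrow> D i (t l) = of_bool (i = l)"
    by (rule independent_derivations[OF S(1,2), where N = "2 * j"]) (rule that)
  \<comment> \<open>Parameters with index below \<open>j\<close> multiply the pure powers, those
    with index above \<open>j\<close> the mixed terms, so that all of them are independent.\<close>
  let ?h = "system_section j (a j) t (\<lambda>i. t (j + i))"
  have "quasismooth (j - 1) (psubst (PVar(VarX j := ?h)) F)" if FF: "F \<in> \<F>" for F
    unfolding quasismooth_def smooth_hypersurface_on_iff
  proof (intro ballI notI)
    fix u assume u: "u \<in> cox_domain (j - 1)"
      and sing: "singular_at (cox_vars (j - 1)) (psubst (PVar(VarX j := ?h)) F) u"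
    have F: "F \<in> cox_ring j" "quasismooth j F" using \<F>[OF FF] by auto
    obtain d where hom: "bihomogeneous a e d F"
      using \<F>[OF FF, THEN conjunct2, THEN conjunct1] by (rule exE)
    have j1: "j \<ge> 1" and a0: "a 0 = 1" using j a(1)[of 0] by simp_all
    have coeffs: "D i (lookup F m) = 0" if "i < 2 * j" for i m
    proof -
      have "lookup F ` keys F \<subseteq> S" using S(3) FF by blast
      then have "lookup F m \<in> S"
        using subring_zero[OF S(2)] by (cases "m \<in> keys F") (auto simp: not_in_keys_iff_lookup_eq_zero)
      then show ?thesis using D(2)[OF that] by simp
    qed
    \<comment> \<open>Stated for every singular point, since it is applied both to \<open>u\<close>
      and to its normalization \<open>w\<close>.\<close>
    have off_base: "peval (u(VarX j := peval u ?h)) (pdiff (VarX j) F) \<noteq> 0"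
      "\<And>l. 1 \<le> l \<Longrightarrow> l < j \<Longrightarrow> u (VarX l) = 0"
      if "u \<in> cox_domain (j - 1)" "singular_at (cox_vars (j - 1)) (psubst (PVar(VarX j := ?h)) F) u" for u
      using D(1,3) coeffs by (intro generic_section_off_base[OF j1 F that, where \<delta> = D]; simp)+
    have zero: "u (VarX i) = 0" if "1 \<le> i" "i \<le> j - 1" for i
      using off_base(2)[OF u sing, of i] that j by simp
    show False
    proof (rule normalize_point[OF a0 bihomogeneous_section[OF a j1 F(1) hom] u zero sing])
      fix w b
      assume w: "singular_at (cox_vars (j - 1)) (psubst (PVar(VarX j := ?h)) F) w" "w (VarX 0) = 1"
        and b: "b \<in> {VarY, VarZ}" "\<And>v. v \<in> {VarY, VarZ} \<Longrightarrow> v \<noteq> b \<Longrightarrow> w v = 1"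
      have w_dom: "w \<in> cox_domain (j - 1)"
        using w(2) b by (force simp: cox_domain_def)
      have small: "j + l < 2 * j" if "l \<in> {1, 2}" for l using that j by auto
      have "peval (w(VarX j := peval w ?h)) (pdiff (VarX j) F) = 0"
      \<comment> \<open>The derivations \<open>D (j + 1)\<close> and \<open>D (j + 2)\<close> are
        dual to the first two mixed parameters and kill the parameters of the pure powers.\<close>
      proof (rule generic_section_on_base[OF j a(2) F(1) w off_base(2)[OF w_dom w(1)] b,
            where \<delta> = "\<lambda>l. D (j + l)"])
        fix l i :: nat assume l: "l \<in> {1, 2}" and i: "i \<in> {1, 2}"
        have "i < 2 * j" "j + l \<noteq> i" using i l j by auto
        then show "D (j + l) (t i) = 0" using D(3)[OF small[OF l]] by simp
        show "D (j + l) (t (j + i)) = of_bool (l = i)"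
          using D(3)[OF small[OF l] small[OF i]] by simp
      qed (simp_all add: small D(1) coeffs)
      then show False using off_base(1)[OF w_dom w(1)] by simp
    qed
  qed
  then show ?thesis using that by blast
qed

section \<open>Successive sections\<close>

definition shear :: "nat \<Rightarrow> cpoly \<Rightarrow> cox_var \<Rightarrow> cpoly" where
  "shear j h = PVar(VarX j := PVar (VarX j) + h)"

lemma restrict_x_simps [simp]:
  "restrict_x j (PConst c) = PConst c" "restrict_x j 0 = 0" "restrict_x j 1 = 1"
  "restrict_x j (PVar (VarX i)) = (if i \<le> j then PVar (VarX i) else 0)"
  "restrict_x j (PVar VarY) = PVar VarY" "restrict_x j (PVar VarZ) = PVar VarZ"
  "restrict_x j (p + q) = restrict_x j p + restrict_x j q"
  "restrict_x j (p * q) = restrict_x j p * restrict_x j q"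
  by (simp_all add: restrict_x_def)

lemma restrict_E_simps [simp]:
  "restrict_E (PConst c) = PConst c" "restrict_E 0 = 0" "restrict_E 1 = 1"
  "restrict_E (PVar (VarX i)) = PVar (VarX i)"
  "restrict_E (PVar VarY) = 1" "restrict_E (PVar VarZ) = 0"
  "restrict_E (p + q) = restrict_E p + restrict_E q"
  "restrict_E (p * q) = restrict_E p * restrict_E q"
  by (simp_all add: restrict_E_def)

lemma xvarsE:
  assumes "v \<in> xvars j"
  obtains i where "i \<le> j" "v = VarX i"
  using assms by (auto simp: xvars_def)

lemma restrict_x_fixed: "p \<in> polys_in (xvars j) \<Longrightarrow> restrict_x j p = p"
  by (rule polys_in_induct[where V = "xvars j" and K = UNIV]) (auto elim!: xvarsE)

lemma restrict_E_fixed: "p \<in> polys_in (xvars j) \<Longrightarrow> restrict_E p = p"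
  by (rule polys_in_induct[where V = "xvars j" and K = UNIV]) (auto elim!: xvarsE)

lemma restrict_x_cox_ring: "p \<in> cox_ring n \<Longrightarrow> restrict_x j p \<in> cox_ring j"
  unfolding restrict_x_def cox_ring_def by (rule polys_in_psubst) (auto split: cox_var.splits)

lemma restrict_x_cox_ring_fixed: "p \<in> cox_ring n \<Longrightarrow> restrict_x n p = p"
  unfolding cox_ring_def
  by (rule polys_in_induct[where V = "cox_vars n" and K = UNIV]) (auto elim!: xvarsE)

lemma restrict_E_in: "p \<in> cox_ring n \<Longrightarrow> restrict_E p \<in> polys_in (xvars n)"
  unfolding restrict_E_def cox_ring_def by (rule polys_in_psubst) (auto split: cox_var.splits)

lemma polys_in_xvars_mono: "p \<in> polys_in (xvars i) \<Longrightarrow> i \<le> j \<Longrightarrow> p \<in> polys_in (xvars j)"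
  by (rule subsetD[OF polys_in_mono]) (auto simp: xvars_def)

lemma polys_in_xvars_cox_ring: "p \<in> polys_in (xvars j) \<Longrightarrow> p \<in> cox_ring j"
  unfolding cox_ring_def by (rule subsetD[OF polys_in_mono]) auto

lemma homogeneous_restrict_x: "homogeneous w d p \<Longrightarrow> homogeneous w d (restrict_x j p)"
  unfolding restrict_x_def
  by (rule homogeneous_psubst[OF _ polys_in_UNIV]) (auto split: cox_var.splits)

text \<open>Neither x_j nor a variable of \<open>h\<close> is set to 0 by the restriction, so the
  shear acts on each coordinate subspace of index at least \<open>j\<close>.\<close>

lemma restrict_x_shear:
  assumes "h \<in> polys_in (xvars (j - 1))" "1 \<le> j" "j \<le> i"
  shows "restrict_x i (psubst (shear j h) G) = psubst (shear j h) (restrict_x i G)"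
proof -
  have "restrict_x i h = h"
    using assms by (intro restrict_x_fixed polys_in_xvars_mono[OF assms(1)]) auto
  then have "restrict_x i (psubst (shear j h) (PVar v)) = psubst (shear j h) (restrict_x i (PVar v))" for v
    using assms(3) by (cases v) (auto simp: shear_def)
  then show ?thesis
    by (induction G rule: cpoly_induct) simp_all
qed

lemma restrict_x_shear_pred:
  assumes "h \<in> polys_in (xvars (j - 1))" "1 \<le> j"
  shows "restrict_x (j - 1) (psubst (shear j h) G) = psubst (PVar(VarX j := h)) (restrict_x j G)"
proof -
  have "restrict_x (j - 1) h = h"
    using assms by (intro restrict_x_fixed)
  then have "restrict_x (j - 1) (psubst (shear j h) (PVar v)) = psubst (PVar(VarX j := h)) (restrict_x j (PVar v))" for v
    using assms(2) by (cases v) (auto simp: shear_def)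
  then show ?thesis
    by (induction G rule: cpoly_induct) simp_all
qed

text \<open>The shear is invertible and maps singular points to singular points; \<open>h0\<close>
  ensures that it moves no point of the domain to a point with all x-coordinates 0. This keeps the
  earlier sections quasi-smooth.\<close>

lemma quasismooth_shear:
  assumes j: "1 \<le> j" "j \<le> i" and h: "h \<in> polys_in (xvars (j - 1))"
    and h0: "\<And>u. (\<And>l. l < j \<Longrightarrow> u (VarX l) = 0) \<Longrightarrow> peval u h = 0"
    and G: "G \<in> cox_ring i" "quasismooth i G"
  shows "quasismooth i (psubst (shear j h) G)"
  unfolding quasismooth_def smooth_hypersurface_on_iff
proof (intro ballI notI)
  fix u assume u: "u \<in> cox_domain i" and sing: "singular_at (cox_vars i) (psubst (shear j h) G) u"
  define u' where "u' = u(VarX j := u (VarX j) + peval u h)"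
  have "pdiff (VarX j) h = 0"
    using j by (intro pdiff_not_occurring[OF h]) auto
  have sing_d: "peval u (pdiff v (psubst (shear j h) G)) = 0" if "v \<in> cox_vars i" for v
    using sing that unfolding singular_at_def by blast
  have diff: "peval u (pdiff v (psubst (shear j h) G)) = (if v = VarX j then 0 else peval u' (pdiff v G)) +
      peval u' (pdiff (VarX j) G) * peval u (pdiff v (PVar (VarX j) + h))" for v
    using peval_pdiff_psubst_update[of "cox_vars i" G "VarX j" u v "PVar (VarX j) + h"] G j
    by (simp add: shear_def cox_ring_def u'_def)
  \<comment> \<open>Because \<open>h\<close> is free of x_j, the Jacobian of the shear is unipotent:
    the derivative in x_j comes first, the others follow.\<close>
  have dj: "peval u' (pdiff (VarX j) G) = 0"
    using diff[of "VarX j"] sing_d[of "VarX j"] j \<open>pdiff (VarX j) h = 0\<close> by (simp add: pdiff_add)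
  have "peval u' (pdiff v G) = 0" if "v \<in> cox_vars i" for v
    using diff[of v] sing_d[OF that] dj by (cases "v = VarX j") auto
  moreover have "peval u' G = 0"
    using sing by (simp add: singular_at_def shear_def peval_psubst_update u'_def)
  ultimately have "singular_at (cox_vars i) G u'"
    unfolding singular_at_def by blast
  moreover have "\<exists>l\<le>i. u' (VarX l) \<noteq> 0"
  proof (rule ccontr)
    assume "\<not> (\<exists>l\<le>i. u' (VarX l) \<noteq> 0)"
    then have zero: "u' (VarX l) = 0" if "l \<le> i" for l using that by blast
    have less: "u (VarX l) = 0" if "l < j" for l
      using zero[of l] that j by (simp add: u'_def)
    have "peval u h = 0" by (rule h0) (rule less)
    then have "u (VarX l) = 0" if "l \<le> i" for l
      using zero[OF that] by (cases "l = j") (auto simp: u'_def)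
    then show False using u by (auto simp: cox_domain_def)
  qed
  then have "u' \<in> cox_domain i"
    using u by (simp add: cox_domain_def u'_def)
  ultimately show False
    using G(2) by (auto simp: quasismooth_def smooth_hypersurface_on_iff)
qed

section \<open>Graded substitutions and the descending induction\<close>

definition graded_subst :: "nat \<Rightarrow> (nat \<Rightarrow> nat) \<Rightarrow> (cox_var \<Rightarrow> cpoly) \<Rightarrow> bool" where
  "graded_subst n a \<sigma> \<longleftrightarrow> \<sigma> VarY = PVar VarY \<and> \<sigma> VarZ = PVar VarZ \<and>
     (\<forall>i\<le>n. \<sigma> (VarX i) \<in> polys_in (xvars n) \<and> homogeneous (x_deg a) (int (a i)) (\<sigma> (VarX i)))"

lemma graded_subst_PVar: "graded_subst n a PVar"
  by (auto simp: graded_subst_def)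

text \<open>For the last claim, the images of the x-coordinates contain neither y nor z, and y, z
  are fixed; so the substitution commutes with setting y = 1 and z = 0.\<close>

lemma
  assumes "graded_subst n a \<sigma>"
  shows graded_subst_polys_in: "p \<in> polys_in (xvars n) \<Longrightarrow> psubst \<sigma> p \<in> polys_in (xvars n)"
    and graded_subst_cox_ring: "p \<in> cox_ring n \<Longrightarrow> psubst \<sigma> p \<in> cox_ring n"
    and graded_subst_homogeneous:
      "p \<in> polys_in (xvars n) \<Longrightarrow> homogeneous (x_deg a) d p \<Longrightarrow> homogeneous (x_deg a) d (psubst \<sigma> p)"
    and graded_subst_restrict_E: "p \<in> cox_ring n \<Longrightarrow> restrict_E (psubst \<sigma> p) = psubst \<sigma> (restrict_E p)"
proof -
  have X: "\<sigma> (VarX i) \<in> polys_in (xvars n)" "homogeneous (x_deg a) (int (a i)) (\<sigma> (VarX i))" if "i \<le> n" for i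
    using assms that by (auto simp: graded_subst_def)
  have YZ: "\<sigma> VarY = PVar VarY" "\<sigma> VarZ = PVar VarZ"
    using assms by (auto simp: graded_subst_def)
  show "psubst \<sigma> p \<in> polys_in (xvars n)" if "p \<in> polys_in (xvars n)"
    using that by (rule polys_in_psubst) (auto elim!: xvarsE intro: X)
  show "psubst \<sigma> p \<in> cox_ring n" if "p \<in> cox_ring n"
    using that unfolding cox_ring_def
  proof (rule polys_in_psubst)
    fix v assume v: "v \<in> cox_vars n"
    show "\<sigma> v \<in> polys_in (cox_vars n)"
    proof (cases v)
      case (VarX i)
      then show ?thesis
        using v polys_in_xvars_cox_ring[OF X(1), of i] by (simp add: cox_ring_def)
    qed (simp_all add: YZ)
  qed
  show "homogeneous (x_deg a) d (psubst \<sigma> p)" if "p \<in> polys_in (xvars n)" "homogeneous (x_deg a) d p"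
    using that(2,1) by (rule homogeneous_psubst) (auto elim!: xvarsE simp: X)
  show "restrict_E (psubst \<sigma> p) = psubst \<sigma> (restrict_E p)" if "p \<in> cox_ring n"
    using that[unfolded cox_ring_def]
  proof (rule polys_in_induct[where K = UNIV])
    fix v assume "v \<in> cox_vars n"
    then show "restrict_E (psubst \<sigma> (PVar v)) = psubst \<sigma> (restrict_E (PVar v))"
      using restrict_E_fixed[OF X(1)] by (cases v) (simp_all add: YZ)
  qed simp_all
qed

lemma graded_subst_comp:
  assumes \<alpha>: "graded_subst n a \<alpha>" and \<beta>: "graded_subst n a \<beta>"
  shows "graded_subst n a (\<lambda>v. psubst \<alpha> (\<beta> v))"
  unfolding graded_subst_def
proof (intro conjI allI impI)
  show "psubst \<alpha> (\<beta> VarY) = PVar VarY" "psubst \<alpha> (\<beta> VarZ) = PVar VarZ"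
    using assms by (simp_all add: graded_subst_def)
  fix i assume "i \<le> n"
  then have i: "\<beta> (VarX i) \<in> polys_in (xvars n)" "homogeneous (x_deg a) (int (a i)) (\<beta> (VarX i))"
    using \<beta> by (simp_all add: graded_subst_def)
  show "psubst \<alpha> (\<beta> (VarX i)) \<in> polys_in (xvars n)"
    by (rule graded_subst_polys_in[OF \<alpha> i(1)])
  show "homogeneous (x_deg a) (int (a i)) (psubst \<alpha> (\<beta> (VarX i)))"
    by (rule graded_subst_homogeneous[OF \<alpha> i])
qed

text \<open>On polynomials in the x-coordinates the first Cox grading is the weighted degree and the
  second is trivial.\<close>

lemma graded_subst_bihomogeneous:
  assumes \<sigma>: "graded_subst n a \<sigma>" and p: "p \<in> cox_ring n" "bihomogeneous a e d p"
  shows "bihomogeneous a e d (psubst \<sigma> p)"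
proof -
  have \<sigma>X: "homogeneous (\<lambda>v. fst (cox_deg a e v)) (int (a i)) (\<sigma> (VarX i))"
    "homogeneous (\<lambda>v. snd (cox_deg a e v)) 0 (\<sigma> (VarX i))" if "i \<le> n" for i
  proof -
    have in_x: "\<sigma> (VarX i) \<in> polys_in (xvars n)" "homogeneous (x_deg a) (int (a i)) (\<sigma> (VarX i))"
      using \<sigma> that by (auto simp: graded_subst_def)
    then show "homogeneous (\<lambda>v. fst (cox_deg a e v)) (int (a i)) (\<sigma> (VarX i))"
      by (subst homogeneous_cong[where w' = "x_deg a"]) (auto simp: xvars_def)
    show "homogeneous (\<lambda>v. snd (cox_deg a e v)) 0 (\<sigma> (VarX i))"
      using in_x(1) by (subst homogeneous_cong[where w' = "\<lambda>_. 0"]) (auto simp: xvars_def homogeneous_def)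
  qed
  have YZ: "\<sigma> VarY = PVar VarY" "\<sigma> VarZ = PVar VarZ"
    using \<sigma> by (auto simp: graded_subst_def)
  show ?thesis
    using p unfolding bihomogeneous_def cox_ring_def
    by (intro conjI; elim conjE homogeneous_psubst) (auto simp: \<sigma>X YZ xvars_def)
qed

text \<open>This is the assignment at which \<open>aut_on_points\<close> evaluates for
  \<open>base_point\<close>.\<close>

definition base_values :: "cox_var \<Rightarrow> complex" where
  "base_values v = (case v of VarX l \<Rightarrow> base_point l | _ \<Rightarrow> 0)"

text \<open>Descending induction on \<open>m\<close>: \<sigma> transforms equations and its inverse
  \<tau> gives the coordinates of the automorphism. Each step appends a shear that is generic for
  the equations already restricted to index \<open>Suc m\<close>.\<close>

lemma successive_sections:
  assumes n: "n \<ge> 3" and a: "\<And>i. i < n \<Longrightarrow> a i = 1" "1 \<le> a n" and "finite \<F>"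
    and \<F>: "\<And>F. F \<in> \<F> \<Longrightarrow> F \<in> cox_ring n \<and> (\<exists>d. bihomogeneous a e d F) \<and> quasismooth n F"
    and m: "2 \<le> m" "m \<le> n"
  shows "\<exists>\<sigma> \<tau>. graded_subst n a \<sigma> \<and> graded_subst n a \<tau> \<and>
    (\<forall>v. psubst \<sigma> (\<tau> v) = PVar v) \<and> (\<forall>v. psubst \<tau> (\<sigma> v) = PVar v) \<and>
    (\<forall>i\<le>n. peval base_values (\<tau> (VarX i)) = base_point i) \<and>
    (\<forall>F\<in>\<F>. \<forall>i. m \<le> i \<longrightarrow> i \<le> n \<longrightarrow> quasismooth i (restrict_x i (psubst \<sigma> F)))"
  using m(2,1)
proof (induction m rule: inc_induct)
  case base
  have "\<forall>F\<in>\<F>. \<forall>i. n \<le> i \<longrightarrow> i \<le> n \<longrightarrow> quasismooth i (restrict_x i (psubst PVar F))"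
    using \<F> restrict_x_cox_ring_fixed by (auto dest!: antisym)
  then show ?case
    by (intro exI[of _ PVar]) (simp add: graded_subst_PVar base_values_def)
next
  case (step m)
  define j where "j = Suc m"
  have j: "3 \<le> j" "1 \<le> j" "j \<le> n" "j - 1 = m" using step by (auto simp: j_def)
  obtain \<sigma> \<tau> where \<sigma>: "graded_subst n a \<sigma>" and \<tau>: "graded_subst n a \<tau>"
    and \<sigma>\<tau>: "\<And>v. psubst \<sigma> (\<tau> v) = PVar v" and \<tau>\<sigma>: "\<And>v. psubst \<tau> (\<sigma> v) = PVar v"
    and base: "\<And>i. i \<le> n \<Longrightarrow> peval base_values (\<tau> (VarX i)) = base_point i"
    and qs: "\<And>F i. F \<in> \<F> \<Longrightarrow> j \<le> i \<Longrightarrow> i \<le> n \<Longrightarrow> quasismooth i (restrict_x i (psubst \<sigma> F))"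
    using step unfolding j_def by (metis le_SucI)
  have aj: "1 \<le> a j" "a i = 1" if "i < j" for i
    using a(1)[of i] a(1)[of j] a(2) that j(3) by (cases "j = n"; simp)+
  have j0: "0 < j" using j by simp
  obtain s t where st: "\<And>G. G \<in> (\<lambda>F. restrict_x j (psubst \<sigma> F)) ` \<F> \<Longrightarrow>
      quasismooth (j - 1) (psubst (PVar(VarX j := system_section j (a j) s t)) G)"
  proof (rule generic_section[where j = j and a = a and e = e and
        \<F> = "(\<lambda>F. restrict_x j (psubst \<sigma> F)) ` \<F>", OF j(1) aj(2) aj(1)[OF j0]])
    fix G assume "G \<in> (\<lambda>F. restrict_x j (psubst \<sigma> F)) ` \<F>"
    then obtain F where F: "F \<in> \<F>" "G = restrict_x j (psubst \<sigma> F)" by auto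
    have F_cox: "F \<in> cox_ring n" using \<F>[OF F(1)] by (elim conjE)
    obtain d where "bihomogeneous a e d F" using \<F>[OF F(1), THEN conjunct2, THEN conjunct1] by (rule exE)
    with F_cox have "bihomogeneous a e d (psubst \<sigma> F)"
      by (rule graded_subst_bihomogeneous[OF \<sigma>])
    then have "bihomogeneous a e d G"
      by (simp add: F(2) bihomogeneous_def homogeneous_restrict_x)
    moreover have "G \<in> cox_ring j"
      unfolding F(2) by (rule restrict_x_cox_ring[OF graded_subst_cox_ring[OF \<sigma> F_cox]])
    moreover have "quasismooth j G"
      unfolding F(2) by (rule qs[OF F(1) order_refl j(3)])
    ultimately show "G \<in> cox_ring j \<and> (\<exists>d. bihomogeneous a e d G) \<and> quasismooth j G"
      by blast
  next
    show "finite ((\<lambda>F. restrict_x j (psubst \<sigma> F)) ` \<F>)" using assms(4) by (rule finite_imageI)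
  qed (assumption, rule that, blast)
  define h where "h = system_section j (a j) s t"
  have h: "h \<in> polys_in (xvars (j - 1))" "h \<in> polys_in (xvars n)"
    using system_section_in[of j "a j" s t] polys_in_xvars_mono[of h "j - 1" n] j by (auto simp: h_def)
  have h0: "peval u h = 0" if "\<And>i. 1 \<le> i \<Longrightarrow> i < j \<Longrightarrow> u (VarX i) = 0" for u
    unfolding h_def by (rule peval_system_section_zero[OF aj(1)[OF j0]]) (rule that)
  have hdeg: "homogeneous (x_deg a) (int (a j)) h"
    using homogeneous_system_section[OF aj(1)[OF j0], of j "x_deg a" 1 s t] aj(2) by (simp add: h_def)
  have shear_graded: "graded_subst n a (shear j g)"
    if "g \<in> polys_in (xvars n)" "homogeneous (x_deg a) (int (a j)) g" for g
    using that j(3) by (simp add: graded_subst_def shear_def polys_in_add homogeneous_add)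
  \<comment> \<open>The section does not contain x_j, hence the shears by \<open>h\<close> and
    \<open>- h\<close> are mutually inverse.\<close>
  have h_fixed: "psubst (shear j g) h = h" for g
    using j(2) by (subst psubst_cong[OF h(1), where \<tau> = PVar]) (auto simp: shear_def xvars_def)
  \<comment> \<open>On equations the new shear acts after \<sigma>; the inverse is composed in the
    opposite order.\<close>
  define \<sigma>' where "\<sigma>' = (\<lambda>v. psubst (shear j h) (\<sigma> v))"
  define \<tau>' where "\<tau>' = (\<lambda>v. psubst \<tau> (shear j (- h) v))"
  have comp: "psubst \<sigma>' p = psubst (shear j h) (psubst \<sigma> p)" "psubst \<tau>' p = psubst \<tau> (psubst (shear j (- h)) p)" for p
    unfolding \<sigma>'_def \<tau>'_def by (rule psubst_psubst[symmetric])+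
  have neg_h: "- h \<in> polys_in (xvars n)" "homogeneous (x_deg a) (int (a j)) (- h)"
    using polys_in_diff[OF polys_in_zero h(2)] homogeneous_minus[OF hdeg] by simp_all
  have shear_neg: "psubst (shear j h) (shear j (- h) v) = PVar v" "psubst (shear j (- h)) (shear j h v) = PVar v" for v
  proof -
    have "psubst (shear j h) (PVar (VarX j) - h) = PVar (VarX j)"
      unfolding psubst_simps h_fixed by (simp add: shear_def)
    then show "psubst (shear j h) (shear j (- h) v) = PVar v"
      by (cases "v = VarX j") (simp_all add: shear_def)
    have "psubst (shear j (- h)) (PVar (VarX j) + h) = PVar (VarX j)"
      unfolding psubst_simps h_fixed by (simp add: shear_def)
    then show "psubst (shear j (- h)) (shear j h v) = PVar v"
      by (cases "v = VarX j") (simp_all add: shear_def)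
  qed
  have "graded_subst n a \<sigma>'" "graded_subst n a \<tau>'"
    unfolding \<sigma>'_def \<tau>'_def by (intro graded_subst_comp shear_graded h neg_h hdeg \<sigma> \<tau>)+
  moreover have "psubst \<sigma>' (\<tau>' v) = PVar v" for v
    unfolding comp \<tau>'_def by (simp add: psubst_psubst[of \<sigma>] \<sigma>\<tau> shear_neg)
  moreover have "psubst \<tau>' (\<sigma>' v) = PVar v" for v
    unfolding comp \<sigma>'_def by (simp add: psubst_psubst[of "shear j (- h)"] shear_neg \<tau>\<sigma>)
  moreover have "peval base_values (\<tau>' (VarX i)) = base_point i" if i: "i \<le> n" for i
  proof -
    \<comment> \<open>This is the value of \<open>h\<close> at the image of the base point under the
      old automorphism, which is again the base point.\<close>
    have "peval base_values (psubst \<tau> h) = 0"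
      unfolding peval_psubst by (rule h0) (use base j in \<open>auto simp: base_point_def\<close>)
    then have "peval base_values (psubst \<tau> (PVar (VarX j) - h)) = peval base_values (\<tau> (VarX j))"
      by simp
    then show ?thesis using base[OF i] by (cases "i = j") (simp_all add: \<tau>'_def shear_def)
  qed
  moreover have "quasismooth i (restrict_x i (psubst \<sigma>' F))" if F: "F \<in> \<F>" and i: "m \<le> i" "i \<le> n" for F i
  proof (cases "j \<le> i")
    case True
    have "restrict_x i (psubst \<sigma> F) \<in> cox_ring i"
      using \<F>[OF F] graded_subst_cox_ring[OF \<sigma>] restrict_x_cox_ring by blast
    then show ?thesis
      unfolding comp restrict_x_shear[OF h(1) j(2) True]
      using j(2) True h(1) h0 qs[OF F True i(2)] by (intro quasismooth_shear) auto
  next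
    case False
    then have "i = j - 1" using i(1) by (simp add: j_def)
    then show ?thesis
      unfolding comp using restrict_x_shear_pred[OF h(1) j(2)] st F by (simp add: h_def)
  qed
  ultimately show ?case by blast
qed

section \<open>Automorphisms and images\<close>

text \<open>The comorphism is substitution by \<tau>, so the equation of the image is obtained with
  its inverse \<sigma>.\<close>

lemma graded_automorphism_psubst:
  assumes "graded_subst n a \<sigma>" "graded_subst n a \<tau>"
    and "\<And>v. psubst \<sigma> (\<tau> v) = PVar v" "\<And>v. psubst \<tau> (\<sigma> v) = PVar v"
  shows "graded_automorphism a n (psubst \<tau>)"
    and "F \<in> cox_ring n \<Longrightarrow> image_equation n (psubst \<tau>) F = psubst \<sigma> F"
proof -
  have inv: "psubst \<sigma> (psubst \<tau> p) = p" "psubst \<tau> (psubst \<sigma> p) = p" for p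
    by (simp_all add: psubst_psubst assms)
  have bij: "bij_betw (psubst \<tau>) (polys_in (xvars n)) (polys_in (xvars n))"
    by (rule bij_betw_byWitness[where f' = "psubst \<sigma>"])
      (auto simp: inv graded_subst_polys_in[OF assms(1)] graded_subst_polys_in[OF assms(2)])
  then show "graded_automorphism a n (psubst \<tau>)"
    unfolding graded_automorphism_def
    by (auto intro: graded_subst_homogeneous[OF assms(2)])
  assume F: "F \<in> cox_ring n"
  have "inv_into (polys_in (xvars n)) (psubst \<tau>) (PVar (VarX i)) = \<sigma> (VarX i)" if "i \<le> n" for i
  proof (rule inv_into_f_eq)
    show "inj_on (psubst \<tau>) (polys_in (xvars n))" using bij by (rule bij_betw_imp_inj_on)
  qed (use assms(1,4) that in \<open>auto simp: graded_subst_def\<close>)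
  then show "image_equation n (psubst \<tau>) F = psubst \<sigma> F"
    unfolding image_equation_def cox_extend_def
    by (intro psubst_cong[OF F[unfolded cox_ring_def]])
      (use assms(1) in \<open>auto simp: graded_subst_def xvars_def\<close>)
qed

section \<open>Quasi-smoothness on the base and smoothness in projective space\<close>

text \<open>The zero polynomial is singular at the point with all coordinates 1. This supplies the
  nonvanishing of the restricted equations.\<close>

lemma quasismooth_nonzero:
  assumes "quasismooth j F"
  shows "F \<noteq> 0"
proof
  assume "F = 0"
  then have "singular_at (cox_vars j) F (\<lambda>_. 1)" by (simp add: singular_at_def pdiff.zero)
  moreover have "(\<lambda>_. 1) \<in> cox_domain j" by (auto simp: cox_domain_def)
  ultimately show False using assms by (auto simp: quasismooth_def smooth_hypersurface_on_iff)
qed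

text \<open>An equation in the x-coordinates alone has no derivative in y or z and is constant along
  the fibres; setting y = 1 lifts a point of the base to the Cox domain.\<close>

lemma quasismooth_iff_wps_quasismooth:
  assumes f: "f \<in> polys_in (xvars j)"
  shows "quasismooth j f \<longleftrightarrow> wps_quasismooth j f"
proof
  assume q: "wps_quasismooth j f"
  then show "quasismooth j f"
    unfolding quasismooth_def wps_quasismooth_def smooth_hypersurface_on_def cox_domain_def by blast
next
  assume q: "quasismooth j f"
  show "wps_quasismooth j f"
    unfolding wps_quasismooth_def smooth_hypersurface_on_iff
  proof (intro ballI notI)
    fix u assume u: "u \<in> {p. \<exists>i\<le>j. p (VarX i) \<noteq> 0}" and sing: "singular_at (xvars j) f u"
    have eval: "peval (u(VarY := 1)) g = peval u g" if "g \<in> polys_in (xvars j)" for g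
      using that by (rule peval_cong) auto
    have "pdiff v f = 0" if "v \<in> {VarY, VarZ}" for v
      by (rule pdiff_not_occurring[OF f]) (use that in auto)
    then have "singular_at (cox_vars j) f (u(VarY := 1))"
      using sing by (auto simp: singular_at_def eval f polys_in_pdiff)
    moreover have "u(VarY := 1) \<in> cox_domain j"
      using u by (auto simp: cox_domain_def)
    ultimately show False using q by (auto simp: quasismooth_def smooth_hypersurface_on_iff)
  qed
qed

text \<open>A chart x_i = 1 controls all derivatives but the one in x_i; Euler's identity recovers
  that one from the others and from the vanishing of \<open>f\<close>.\<close>

lemma wps_quasismooth_imp_proj_smooth:
  assumes f: "f \<in> polys_in (xvars j)" "homogeneous (x_deg (\<lambda>_. 1)) d f" and q: "wps_quasismooth j f"
  shows "proj_smooth j f"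
  unfolding proj_smooth_def smooth_hypersurface_on_iff
proof (intro allI impI ballI notI)
  fix i u assume i: "i \<le> j" and sing: "singular_at (xvars j - {VarX i}) (psubst (PVar(VarX i := 1)) f) u"
  define u' where "u' = u(VarX i := 1)"
  have f0: "peval u' f = 0"
    using sing by (simp add: singular_at_def peval_psubst_update u'_def)
  have d: "peval u' (pdiff v f) = 0" if v: "v \<in> xvars j - {VarX i}" for v
  proof -
    have "peval u (pdiff v (psubst (PVar(VarX i := 1)) f)) = 0"
      using sing v unfolding singular_at_def by blast
    then show ?thesis
      using peval_pdiff_psubst_update[OF finite_xvars f(1), of "VarX i" u v 1] i v pdiff.one by (simp add: u'_def)
  qed
  have "peval u' (\<Sum>v\<in>xvars j. of_int (x_deg (\<lambda>_. 1) v) * (PVar v * pdiff v f)) = peval u' (of_int d * f)"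
    by (simp only: euler_identity[OF f(2,1) finite_xvars])
  then have "(\<Sum>v\<in>xvars j. u' v * peval u' (pdiff v f)) = 0"
    by (simp add: f0 xvars_def sum.reindex inj_on_def)
  moreover have "(\<Sum>v\<in>xvars j. u' v * peval u' (pdiff v f)) = u' (VarX i) * peval u' (pdiff (VarX i) f)"
    using d i by (subst sum.remove[of _ "VarX i"]) auto
  ultimately have "peval u' (pdiff (VarX i) f) = 0" by (simp add: u'_def)
  then have "singular_at (xvars j) f u'"
    using d f0 unfolding singular_at_def by blast
  moreover have "u' \<in> {p. \<exists>i\<le>j. p (VarX i) \<noteq> 0}" using i by (auto simp: u'_def)
  ultimately show False using q by (auto simp: wps_quasismooth_def smooth_hypersurface_on_iff)
qed

section \<open>Construction of the automorphism\<close>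

lemma simultaneous_sections:
  assumes "n \<ge> 3" "\<forall>i<n. a i = 1" "a n \<ge> 2" "finite \<F>"
    and "\<And>F. F \<in> \<F> \<Longrightarrow> F \<in> cox_ring n \<and> (\<exists>d. bihomogeneous a e d F) \<and> quasismooth n F"
  obtains \<sigma> \<tau> where "graded_automorphism a n (psubst \<tau>)" "graded_subst n a \<sigma>"
    "wps_same_point a n (aut_on_points (psubst \<tau>) base_point) base_point"
    "\<And>F. F \<in> cox_ring n \<Longrightarrow> image_equation n (psubst \<tau>) F = psubst \<sigma> F"
    "\<And>F j. F \<in> \<F> \<Longrightarrow> j \<in> {2..n - 1} \<Longrightarrow> quasismooth j (restrict_x j (psubst \<sigma> F))"
proof -
  obtain \<sigma> \<tau> where *: "graded_subst n a \<sigma>" "graded_subst n a \<tau>"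
    "\<And>v. psubst \<sigma> (\<tau> v) = PVar v" "\<And>v. psubst \<tau> (\<sigma> v) = PVar v"
    "\<And>i. i \<le> n \<Longrightarrow> peval base_values (\<tau> (VarX i)) = base_point i"
    "\<And>F i. F \<in> \<F> \<Longrightarrow> 2 \<le> i \<Longrightarrow> i \<le> n \<Longrightarrow> quasismooth i (restrict_x i (psubst \<sigma> F))"
    using successive_sections[of n a \<F> e 2] assms by auto
  have "base_values = (\<lambda>v. case v of VarX l \<Rightarrow> base_point l | _ \<Rightarrow> 0)"
    by (auto simp: base_values_def)
  then have "wps_same_point a n (aut_on_points (psubst \<tau>) base_point) base_point"
    unfolding wps_same_point_def aut_on_points_def
    using *(5) by (intro exI[of _ 1]) simp
  moreover have "quasismooth j (restrict_x j (psubst \<sigma> F))" if "F \<in> \<F>" "j \<in> {2..n - 1}" for F j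
    using *(6)[OF that(1), of j] that(2) by auto
  ultimately show ?thesis
    using that[OF graded_automorphism_psubst(1)[OF *(1-4)] *(1) _ graded_automorphism_psubst(2)[OF *(1-4)]]
    by blast
qed

lemma hypersurface_restrict:
  assumes "graded_subst n a \<sigma>" "hypersurface a e n d F" "quasismooth j (restrict_x j (psubst \<sigma> F))"
  shows "hypersurface a e j d (restrict_x j (psubst \<sigma> F))"
proof -
  have F: "F \<in> cox_ring n" "bihomogeneous a e d F"
    using assms(2) by (auto simp: hypersurface_def bihomogeneous_def)
  show ?thesis
    using graded_subst_bihomogeneous[OF assms(1) F] quasismooth_nonzero[OF assms(3)]
      restrict_x_cox_ring[OF graded_subst_cox_ring[OF assms(1) F(1)]]
    by (simp add: hypersurface_def bihomogeneous_def homogeneous_restrict_x)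
qed

lemma restrict_E_restrict_x: "restrict_E (restrict_x j G) = restrict_x j (restrict_E G)"
proof (induction G rule: cpoly_induct)
  case (var v)
  then show ?case by (cases v) simp_all
qed simp_all

theorem corollary4p8:
  fixes n c k :: nat and a :: "nat \<Rightarrow> nat" and F :: cpoly
  assumes "n \<ge> 3"
    and "\<forall>i<n. a i = 1"
    and "a n \<ge> 2"
    and "a (n + 1) \<ge> 1"
    and "hypersurface a (a (n + 1)) n (int c, int k) F"
    and "quasismooth n F"
  shows "(\<exists>\<Phi>. graded_automorphism a n \<Phi> \<and>
            wps_same_point a n (aut_on_points \<Phi> base_point) base_point \<and>
            (\<forall>j\<in>{2..n - 1}.
               hypersurface a (a (n + 1)) j (int c, int k) (restrict_x j (image_equation n \<Phi> F)) \<and>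
               quasismooth j (restrict_x j (image_equation n \<Phi> F)))) \<and>
         (wps_hypersurface a n c (restrict_E F) \<and> wps_quasismooth n (restrict_E F) \<longrightarrow>
          (\<exists>\<Phi>. graded_automorphism a n \<Phi> \<and>
            wps_same_point a n (aut_on_points \<Phi> base_point) base_point \<and>
            (\<forall>j\<in>{2..n - 1}.
               hypersurface a (a (n + 1)) j (int c, int k) (restrict_x j (image_equation n \<Phi> F)) \<and>
               quasismooth j (restrict_x j (image_equation n \<Phi> F))) \<and>
            (\<forall>j\<in>{2..n - 1}.
               wps_hypersurface (\<lambda>_. 1) j c (restrict_E (restrict_x j (image_equation n \<Phi> F))) \<and>
               proj_smooth j (restrict_E (restrict_x j (image_equation n \<Phi> F))))))"
proof (intro conjI impI)
  have F: "F \<in> cox_ring n" "bihomogeneous a (a (n + 1)) (int c, int k) F"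
    using assms(5) by (auto simp: hypersurface_def bihomogeneous_def)
  show "\<exists>\<Phi>. graded_automorphism a n \<Phi> \<and>
      wps_same_point a n (aut_on_points \<Phi> base_point) base_point \<and>
      (\<forall>j\<in>{2..n - 1}.
         hypersurface a (a (n + 1)) j (int c, int k) (restrict_x j (image_equation n \<Phi> F)) \<and>
         quasismooth j (restrict_x j (image_equation n \<Phi> F)))"
  \<comment> \<open>For the first claim the parameters have to be generic for \<open>F\<close>
    only.\<close>
  proof (rule simultaneous_sections[OF assms(1-3), of "{F}" "a (n + 1)"])
    fix \<sigma> \<tau>
    assume *: "graded_automorphism a n (psubst \<tau>)" "graded_subst n a \<sigma>"
      "wps_same_point a n (aut_on_points (psubst \<tau>) base_point) base_point"
      "\<And>F. F \<in> cox_ring n \<Longrightarrow> image_equation n (psubst \<tau>) F = psubst \<sigma> F"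
      "\<And>G j. G \<in> {F} \<Longrightarrow> j \<in> {2..n - 1} \<Longrightarrow> quasismooth j (restrict_x j (psubst \<sigma> G))"
    then show ?thesis
      using F hypersurface_restrict[OF *(2) assms(5)]
      by (intro exI[of _ "psubst \<tau>"] conjI ballI) auto
  qed (use F assms(6) in auto)
  assume "wps_hypersurface a n c (restrict_E F) \<and> wps_quasismooth n (restrict_E F)"
  then have E: "homogeneous (x_deg a) (int c) (restrict_E F)" "wps_quasismooth n (restrict_E F)"
    and E_in: "restrict_E F \<in> polys_in (xvars n)"
    by (simp_all add: wps_hypersurface_def)
  have E_cox: "restrict_E F \<in> cox_ring n"
    using E_in by (rule polys_in_xvars_cox_ring)
  have "homogeneous (\<lambda>v. fst (cox_deg a (a (n + 1)) v)) (int c) (restrict_E F)"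
    using E(1) by (subst homogeneous_cong[OF E_in, where w' = "x_deg a"]) (auto simp: xvars_def)
  moreover have "homogeneous (\<lambda>v. snd (cox_deg a (a (n + 1)) v)) 0 (restrict_E F)"
    by (subst homogeneous_cong[OF E_in, where w' = "\<lambda>_. 0"]) (auto simp: xvars_def homogeneous_def)
  ultimately have E_hom: "bihomogeneous a (a (n + 1)) (int c, 0) (restrict_E F)"
    by (simp add: bihomogeneous_def)
  show "\<exists>\<Phi>. graded_automorphism a n \<Phi> \<and>
      wps_same_point a n (aut_on_points \<Phi> base_point) base_point \<and>
      (\<forall>j\<in>{2..n - 1}.
         hypersurface a (a (n + 1)) j (int c, int k) (restrict_x j (image_equation n \<Phi> F)) \<and>
         quasismooth j (restrict_x j (image_equation n \<Phi> F))) \<and>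
      (\<forall>j\<in>{2..n - 1}.
         wps_hypersurface (\<lambda>_. 1) j c (restrict_E (restrict_x j (image_equation n \<Phi> F))) \<and>
         proj_smooth j (restrict_E (restrict_x j (image_equation n \<Phi> F))))"
  \<comment> \<open>One automorphism is chosen generic for \<open>F\<close> and for the equation of
    its restriction to z = 0 together.\<close>
  proof (rule simultaneous_sections[OF assms(1-3), of "{F, restrict_E F}" "a (n + 1)"])
    fix \<sigma> \<tau>
    assume *: "graded_automorphism a n (psubst \<tau>)" "graded_subst n a \<sigma>"
      "wps_same_point a n (aut_on_points (psubst \<tau>) base_point) base_point"
      "\<And>F. F \<in> cox_ring n \<Longrightarrow> image_equation n (psubst \<tau>) F = psubst \<sigma> F"
      "\<And>G j. G \<in> {F, restrict_E F} \<Longrightarrow> j \<in> {2..n - 1} \<Longrightarrow> quasismooth j (restrict_x j (psubst \<sigma> G))"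
    have "wps_hypersurface (\<lambda>_. 1) j c (restrict_E (restrict_x j (psubst \<sigma> F))) \<and>
        proj_smooth j (restrict_E (restrict_x j (psubst \<sigma> F)))" if j: "j \<in> {2..n - 1}" for j
    proof -
      define f where "f = restrict_E (restrict_x j (psubst \<sigma> F))"
      \<comment> \<open>Restriction to z = 0 commutes with the automorphism and with the coordinate
        sections, so the quasi-smoothness obtained for \<open>restrict_E F\<close> applies to
        \<open>f\<close>.\<close>
      have f_eq: "f = restrict_x j (psubst \<sigma> (restrict_E F))"
        by (simp add: f_def restrict_E_restrict_x graded_subst_restrict_E[OF *(2) F(1)])
      have f_in: "f \<in> polys_in (xvars j)"
        unfolding f_def by (rule restrict_E_in[OF restrict_x_cox_ring[OF graded_subst_cox_ring[OF *(2) F(1)]]])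
      have "homogeneous (x_deg a) (int c) f"
        unfolding f_eq by (intro homogeneous_restrict_x graded_subst_homogeneous[OF *(2)] E E_in)
      \<comment> \<open>As \<open>j < n\<close>, only coordinates of weight 1 remain, and the
        weighted degree is the ordinary one.\<close>
      then have f_hom: "homogeneous (x_deg (\<lambda>_. 1)) (int c) f"
        using assms(1,2) j by (subst homogeneous_cong[OF f_in, where w' = "x_deg a"]) (auto simp: xvars_def)
      have q: "quasismooth j f"
        unfolding f_eq using *(5) j by simp
      then have "wps_quasismooth j f"
        using quasismooth_iff_wps_quasismooth[OF f_in] by simp
      then show ?thesis
        unfolding f_def[symmetric] wps_hypersurface_def
        using f_in f_hom quasismooth_nonzero[OF q] wps_quasismooth_imp_proj_smooth by blast
    qed
    then show ?thesis
      using * F hypersurface_restrict[OF *(2) assms(5)]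
      by (intro exI[of _ "psubst \<tau>"] conjI ballI) auto
  qed (use F E_cox E_hom E(2) quasismooth_iff_wps_quasismooth[OF E_in] assms(6) in auto)
qed

end
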